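(* Let $\mathcal{A}$ be a central hyperplane arrangement in $V\cong\mathbb{K}^\ell$ with defining polynomial $Q$, let $\theta_1,\dots,\theta_{\ell+1}\in D(\mathcal{A})$ be homogeneous derivations, and let $g_1,\dots,g_{\ell+1}\in S$ be the polynomials determined by $(-1)^i\det M_i=g_iQ$ for $i=1,\dots,\ell+1$. Assume that $g_{\ell+1}\in S_1\setminus\{0\}$, and that $g_1,\dots,g_\ell\in S_{>0}$ have no non-trivial common divisor modulo $g_{\ell+1}$. If $\operatorname{pd}D(\mathcal{A})\le 1$, then $\mathcal{A}$ is SPOG; that is, $\theta_1,\dots,\theta_{\ell+1}$ form a minimal generating set for $D(\mathcal{A})$ with the unique relation \[ g_1\theta_1+\cdots+g_{\ell+1}\theta_{\ell+1}=0 . \]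
   Context: $\mathbb{K}$ is a field, $V\cong\mathbb{K}^\ell$, and $S=\mathrm{Sym}(V^* )\cong\mathbb{K}[x_1,\dots,x_\ell]$ with the standard grading; $S_1$ is the space of linear forms and $S_{>0}=\bigoplus_{d\ge1}S_d$. A central arrangement $\mathcal{A}$ is a finite set of linear hyperplanes in $V$; $\alpha_H\in V^*$ is a defining linear form of $H\in\mathcal{A}$, and $Q=Q(\mathcal{A})=\prod_{H\in\mathcal{A}}\alpha_H$. The module of logarithmic derivations is the graded $S$-module \[ D(\mathcal{A})=\{\theta\in\mathrm{Der}_{\mathbb{K}}(S)=\textstyle\bigoplus_{i=1}^{\ell}S\,\partial_{x_i}\mid\theta(\alpha_H)\in\alpha_HS\text{ for all }H\in\mathcal{A}\}. \] A derivation $\theta$ is homogeneous of degree $d$ if all $\theta(x_j)$ lie in $S_d$. $\operatorname{pd}$ denotes projective dimension over $S$. For $\theta_1,\dots,\theta_{\ell+1}\in D(\mathcal{A})$, let $M=M[\theta_1,\dots,\theta_{\ell+1}]$ be the $(\ell+1)\times\ell$ matrix with $(i,j)$-entry $\theta_i(x_j)$, and let $M_i$ be the $\ell\times\ell$ matrix obtained from $M$ by deleting the $i$-th row. Every $\det M_i$ is divisible by $Q$ (standard fact), so $g_i\in S$ is well defined by $(-1)^i\det M_i=g_iQ$. Polynomials $f_1,\dots,f_p\in S$ have a non-trivial common divisor $h$ modulo $f$ if there exists $h\in S_{>0}$ such that $f_i\in(h,f)$ (the ideal generated by $h$ and $f$) for all $i$. $\mathcal{A}$ is strictly plus-one generated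 (SPOG) if $D(\mathcal{A})$ requires exactly $\ell+1$ minimal homogeneous generators $\theta_1,\dots,\theta_{\ell+1}$, which satisfy a unique generating relation $f_1\theta_1+\cdots+f_{\ell+1}\theta_{\ell+1}=0$ with $f_1,\dots,f_{\ell+1}\in S$ and $f_{\ell+1}\in S_1\setminus\{0\}$. "Unique (generating) relation" means that the module of all $S$-linear relations among the generators is generated by this single relation. *)

theory Defs
  imports
    "HOL-Library.Poly_Mapping"
    "HOL-Library.Extended_Nat"
    "HOL-Library.FuncSet"
    "HOL-Algebra.Module"
    "HOL-Algebra.Ideal"
    "Jordan_Normal_Form.Determinant"
begin

section \<open>The graded polynomial ring\<close>

text \<open>
  A monomial is its exponent vector and a polynomial its coefficient function.  The ring
  \<open>S\<close> in \<open>l\<close> variables \<open>X 0, \<dots>, X (l - 1)\<close> is a subring of the type of polynomials in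
  countably many variables; the variables are numbered from 0 to agree with
  \<^typ>\<open>'k vec\<close> and \<^typ>\<open>'k mat\<close>.
\<close>

type_synonym 'k mvpoly = "(nat \<Rightarrow>\<^sub>0 nat) \<Rightarrow>\<^sub>0 'k"

definition poly_ring :: "nat \<Rightarrow> 'k::field mvpoly ring" where
  "poly_ring l = \<lparr>carrier = {p. \<forall>m \<in> Poly_Mapping.keys p. Poly_Mapping.keys m \<subseteq> {..<l}},
     monoid.mult = (*), one = 1, zero = 0, add = (+)\<rparr>"

definition Const :: "'k::field \<Rightarrow> 'k mvpoly" where
  "Const c = Poly_Mapping.single 0 c"

definition X :: "nat \<Rightarrow> 'k::field mvpoly" where
  "X j = Poly_Mapping.single (Poly_Mapping.single j 1) 1"

definition mon_deg :: "(nat \<Rightarrow>\<^sub>0 nat) \<Rightarrow> nat" where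
  "mon_deg m = (\<Sum>j \<in> Poly_Mapping.keys m. Poly_Mapping.lookup m j)"

definition homog_part :: "nat \<Rightarrow> nat \<Rightarrow> 'k::field mvpoly set" where
  "homog_part l d = {p \<in> carrier (poly_ring l). \<forall>m \<in> Poly_Mapping.keys p. mon_deg m = d}"

text \<open>The direct sum of the \<open>homog_part l d\<close> over all \<open>d \<ge> 1\<close>; it contains 0.\<close>

definition positive_part :: "nat \<Rightarrow> 'k::field mvpoly set" where
  "positive_part l = {p \<in> carrier (poly_ring l). \<forall>m \<in> Poly_Mapping.keys p. 1 \<le> mon_deg m}"

definition nontrivial_common_divisor_mod ::
  "nat \<Rightarrow> 'i set \<Rightarrow> ('i \<Rightarrow> 'k::field mvpoly) \<Rightarrow> 'k mvpoly \<Rightarrow> bool" where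
  "nontrivial_common_divisor_mod l I p f \<longleftrightarrow>
     (\<exists>h \<in> positive_part l. \<forall>i \<in> I. p i \<in> Idl\<^bsub>poly_ring l\<^esub> {h, f})"

lemma cring_poly_ring: "cring (poly_ring l :: 'k::field mvpoly ring)"
proof (rule cringI)
  have add: "p + q \<in> carrier (poly_ring l)"
    if "p \<in> carrier (poly_ring l)" "q \<in> carrier (poly_ring l)" for p q :: "'k mvpoly"
  proof -
    have "\<forall>m \<in> Poly_Mapping.keys (p + q). m \<in> Poly_Mapping.keys p \<or> m \<in> Poly_Mapping.keys q"
      using Poly_Mapping.keys_add[of p q] by blast
    with that show ?thesis
      unfolding poly_ring_def by (simp, blast)
  qed
  have mult: "p * q \<in> carrier (poly_ring l)"
    if p: "p \<in> carrier (poly_ring l)" and q: "q \<in> carrier (poly_ring l)" for p q :: "'k mvpoly"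
  proof -
    have "Poly_Mapping.keys m \<subseteq> {..<l}" if "m \<in> Poly_Mapping.keys (p * q)" for m
    proof -
      obtain a b where ab: "m = a + b" "a \<in> Poly_Mapping.keys p" "b \<in> Poly_Mapping.keys q"
        using \<open>m \<in> Poly_Mapping.keys (p * q)\<close> keys_mult[of p q] by blast
      have "Poly_Mapping.keys m \<subseteq> Poly_Mapping.keys a \<union> Poly_Mapping.keys b"
        unfolding ab(1) by (rule Poly_Mapping.keys_add)
      moreover have "Poly_Mapping.keys a \<subseteq> {..<l}" "Poly_Mapping.keys b \<subseteq> {..<l}"
        using p q ab(2,3) unfolding poly_ring_def by simp_all
      ultimately show ?thesis by blast
    qed
    then show ?thesis
      unfolding poly_ring_def by simp
  qed
  show "abelian_group (poly_ring l :: 'k mvpoly ring)"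
  proof (rule abelian_groupI)
    fix p :: "'k mvpoly" assume "p \<in> carrier (poly_ring l)"
    then have "- p \<in> carrier (poly_ring l)"
      by (simp add: poly_ring_def)
    then show "\<exists>q \<in> carrier (poly_ring l). q \<oplus>\<^bsub>poly_ring l\<^esub> p = \<zero>\<^bsub>poly_ring l\<^esub>"
      by (rule bexI[rotated]) (simp add: poly_ring_def)
  next
    fix p q :: "'k mvpoly" assume "p \<in> carrier (poly_ring l)" "q \<in> carrier (poly_ring l)"
    from add[OF this] show "p \<oplus>\<^bsub>poly_ring l\<^esub> q \<in> carrier (poly_ring l)"
      by (simp add: poly_ring_def)
  qed (simp_all add: poly_ring_def add_ac)
  show "Group.comm_monoid (poly_ring l :: 'k mvpoly ring)"
  proof (rule comm_monoidI)
    fix p q :: "'k mvpoly" assume "p \<in> carrier (poly_ring l)" "q \<in> carrier (poly_ring l)"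
    from mult[OF this] show "p \<otimes>\<^bsub>poly_ring l\<^esub> q \<in> carrier (poly_ring l)"
      by (simp add: poly_ring_def)
  qed (simp_all add: poly_ring_def mult_ac)
qed (simp add: poly_ring_def distrib_right)


section \<open>Modules: generators, relations, projective dimension\<close>

text \<open>Index sets \<open>I\<close> are meant to be finite (\<open>finsum\<close> is 0 over an infinite support).\<close>

definition lin_comb ::
  "('r, 'm, 'z) module_scheme \<Rightarrow> 'i set \<Rightarrow> ('i \<Rightarrow> 'r) \<Rightarrow> ('i \<Rightarrow> 'm) \<Rightarrow> 'm" where
  "lin_comb M I c x = (\<Oplus>\<^bsub>M\<^esub>i \<in> I. c i \<odot>\<^bsub>M\<^esub> x i)"

definition generates ::
  "('r, 'y) ring_scheme \<Rightarrow> ('r, 'm, 'z) module_scheme \<Rightarrow> 'i set \<Rightarrow> ('i \<Rightarrow> 'm) \<Rightarrow> bool" where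
  "generates R M I x \<longleftrightarrow>
     x \<in> I \<rightarrow> carrier M \<and> carrier M = {lin_comb M I c x | c. c \<in> I \<rightarrow> carrier R}"

definition minimal_generators ::
  "('r, 'y) ring_scheme \<Rightarrow> ('r, 'm, 'z) module_scheme \<Rightarrow> 'i set \<Rightarrow> ('i \<Rightarrow> 'm) \<Rightarrow> bool" where
  "minimal_generators R M I x \<longleftrightarrow>
     generates R M I x \<and> (\<forall>J. J \<subset> I \<longrightarrow> \<not> generates R M J x)"

text \<open>
  The module of all relations among the \<open>x i\<close> is generated by the single relation \<open>f\<close>.
  In particular \<open>f\<close> itself is a relation.
\<close>

definition unique_relation ::
  "('r, 'y) ring_scheme \<Rightarrow> ('r, 'm, 'z) module_scheme \<Rightarrow> 'i set \<Rightarrow> ('i \<Rightarrow> 'm) \<Rightarrow> ('i \<Rightarrow> 'r) \<Rightarrow> bool"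
  where
  "unique_relation R M I x f \<longleftrightarrow>
     f \<in> I \<rightarrow> carrier R \<and>
     {c \<in> I \<rightarrow>\<^sub>E carrier R. lin_comb M I c x = \<zero>\<^bsub>M\<^esub>} = {\<lambda>i \<in> I. a \<otimes>\<^bsub>R\<^esub> f i | a. a \<in> carrier R}"

definition linear_maps ::
  "('r, 'y) ring_scheme \<Rightarrow> ('r, 'm, 'z) module_scheme \<Rightarrow> ('r, 'n, 'w) module_scheme \<Rightarrow> ('m \<Rightarrow> 'n) set"
  where
  "linear_maps R M N = {f \<in> carrier M \<rightarrow> carrier N.
     (\<forall>x \<in> carrier M. \<forall>y \<in> carrier M. f (x \<oplus>\<^bsub>M\<^esub> y) = f x \<oplus>\<^bsub>N\<^esub> f y) \<and>
     (\<forall>a \<in> carrier R. \<forall>x \<in> carrier M. f (a \<odot>\<^bsub>M\<^esub> x) = a \<odot>\<^bsub>N\<^esub> f x)}"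

definition free_module :: "('r, 'y) ring_scheme \<Rightarrow> 'i set \<Rightarrow> ('r, 'i \<Rightarrow> 'r) module" where
  "free_module R I = \<lparr>
     carrier = {u \<in> I \<rightarrow>\<^sub>E carrier R. finite {i \<in> I. u i \<noteq> \<zero>\<^bsub>R\<^esub>}},
     monoid.mult = undefined, one = undefined,
     zero = \<lambda>i \<in> I. \<zero>\<^bsub>R\<^esub>,
     add = (\<lambda>u v. \<lambda>i \<in> I. u i \<oplus>\<^bsub>R\<^esub> v i),
     Module.module.smult = (\<lambda>a u. \<lambda>i \<in> I. a \<otimes>\<^bsub>R\<^esub> u i)\<rparr>"

text \<open>
  Projective means: a direct summand of a free module.  Taking the index set of the free
  module inside the type of \<open>P\<close> is no restriction, because \<open>P\<close> is then also a summand of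
  the free module on \<open>carrier P\<close>.
\<close>

definition projective_module :: "('r, 'y) ring_scheme \<Rightarrow> ('r, 'p, 'z) module_scheme \<Rightarrow> bool" where
  "projective_module R P \<longleftrightarrow> Module.module R P \<and>
     (\<exists>I :: 'p set. \<exists>s \<in> linear_maps R P (free_module R I). \<exists>r \<in> linear_maps R (free_module R I) P.
        \<forall>x \<in> carrier P. r (s x) = x)"

definition lin_kernel ::
  "('r, 'm, 'z) module_scheme \<Rightarrow> ('r, 'n, 'w) module_scheme \<Rightarrow> ('m \<Rightarrow> 'n) \<Rightarrow> 'm set" where
  "lin_kernel M N f = {x \<in> carrier M. f x = \<zero>\<^bsub>N\<^esub>}"

text \<open>An exact sequence \<open>\<dots> \<rightarrow> P 2 \<rightarrow> P 1 \<rightarrow> P 0 \<rightarrow> M \<rightarrow> 0\<close> with \<open>d i : P (i + 1) \<rightarrow> P i\<close>.\<close>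

definition projective_resolution ::
  "('r, 'y) ring_scheme \<Rightarrow> ('r, 'm, 'z) module_scheme \<Rightarrow>
   (nat \<Rightarrow> ('r, 'p) module) \<Rightarrow> (nat \<Rightarrow> 'p \<Rightarrow> 'p) \<Rightarrow> ('p \<Rightarrow> 'm) \<Rightarrow> bool" where
  "projective_resolution R M P d e \<longleftrightarrow>
     (\<forall>i. projective_module R (P i)) \<and>
     (\<forall>i. d i \<in> linear_maps R (P (Suc i)) (P i)) \<and>
     e \<in> linear_maps R (P 0) M \<and>
     e ` carrier (P 0) = carrier M \<and>
     d 0 ` carrier (P 1) = lin_kernel (P 0) M e \<and>
     (\<forall>i. d (Suc i) ` carrier (P (Suc (Suc i))) = lin_kernel (P (Suc i)) (P i) (d i))"

text \<open>
  The projective dimension, i.e. the least length of a projective resolution, \<open>\<infinity>\<close> if there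
  is none of finite length.  HOL cannot quantify over types inside a definition, so the type
  \<^typ>\<open>'p\<close> hosting the modules of the resolution is a parameter.  An assumption
  \<open>proj_dim TYPE('p) R M \<le> n\<close> with a type variable \<^typ>\<open>'p\<close> that does not occur elsewhere is
  satisfied for some instance of \<^typ>\<open>'p\<close> as soon as a resolution of length \<open>n\<close> exists at
  all, so a theorem with this assumption covers all modules of projective dimension at most \<open>n\<close>.
\<close>

definition proj_dim ::
  "'p itself \<Rightarrow> ('r, 'y) ring_scheme \<Rightarrow> ('r, 'm, 'z) module_scheme \<Rightarrow> enat" where
  "proj_dim TYPE('p) R M = Inf {enat n | n.
     \<exists>(P :: nat \<Rightarrow> ('r, 'p) module) d e. projective_resolution R M P d e \<and>
       (\<forall>i > n. carrier (P i) = {\<zero>\<^bsub>P i\<^esub>})}"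


section \<open>Arrangements and logarithmic derivations\<close>

definition linear_form :: "nat \<Rightarrow> 'k::field vec \<Rightarrow> 'k mvpoly" where
  "linear_form l a = (\<Sum>j<l. Const (a $ j) * X j)"

text \<open>
  \<open>defines_hyperplane l p H\<close>: \<open>p\<close> is a nonzero linear form whose zero set in \<open>V = K\<^sup>l\<close> is \<open>H\<close>.
\<close>

definition defines_hyperplane :: "nat \<Rightarrow> 'k::field mvpoly \<Rightarrow> 'k vec set \<Rightarrow> bool" where
  "defines_hyperplane l p H \<longleftrightarrow>
     (\<exists>a \<in> carrier_vec l. a \<noteq> 0\<^sub>v l \<and> p = linear_form l a \<and> H = {v \<in> carrier_vec l. a \<bullet> v = 0})"

definition central_arrangement :: "nat \<Rightarrow> 'k::field vec set set \<Rightarrow> bool" where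
  "central_arrangement l A \<longleftrightarrow> finite A \<and> (\<forall>H \<in> A. \<exists>p. defines_hyperplane l p H)"

text \<open>
  The \<open>K\<close>-derivations of \<open>S\<close>.  They are extensional functions on the carrier of \<open>S\<close>, so that
  equality of derivations is equality in HOL.
\<close>

definition Der :: "nat \<Rightarrow> ('k::field mvpoly \<Rightarrow> 'k mvpoly) set" where
  "Der l = {\<theta> \<in> carrier (poly_ring l) \<rightarrow>\<^sub>E carrier (poly_ring l).
     (\<forall>p \<in> carrier (poly_ring l). \<forall>q \<in> carrier (poly_ring l). \<theta> (p + q) = \<theta> p + \<theta> q) \<and>
     (\<forall>c. \<forall>p \<in> carrier (poly_ring l). \<theta> (Const c * p) = Const c * \<theta> p) \<and>
     (\<forall>p \<in> carrier (poly_ring l). \<forall>q \<in> carrier (poly_ring l). \<theta> (p * q) = \<theta> p * q + p * \<theta> q)}"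

definition homogeneous_der :: "nat \<Rightarrow> ('k::field mvpoly \<Rightarrow> 'k mvpoly) \<Rightarrow> bool" where
  "homogeneous_der l \<theta> \<longleftrightarrow> (\<exists>d. \<forall>j<l. \<theta> (X j) \<in> homog_part l d)"

text \<open>
  The defining form of a hyperplane is unique up to a nonzero scalar, so quantifying over all
  of them agrees with choosing one for each hyperplane.
\<close>

definition log_der :: "nat \<Rightarrow> 'k::field vec set set \<Rightarrow> ('k mvpoly \<Rightarrow> 'k mvpoly) set" where
  "log_der l A = {\<theta> \<in> Der l.
     \<forall>H \<in> A. \<forall>p. defines_hyperplane l p H \<longrightarrow> \<theta> p \<in> PIdl\<^bsub>poly_ring l\<^esub> p}"

definition log_der_module ::
  "nat \<Rightarrow> 'k::field vec set set \<Rightarrow> ('k mvpoly, 'k mvpoly \<Rightarrow> 'k mvpoly) module" where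
  "log_der_module l A = \<lparr>
     carrier = log_der l A,
     monoid.mult = undefined, one = undefined,
     zero = \<lambda>p \<in> carrier (poly_ring l). 0,
     add = (\<lambda>\<theta> \<eta>. \<lambda>p \<in> carrier (poly_ring l). \<theta> p + \<eta> p),
     Module.module.smult = (\<lambda>f \<theta>. \<lambda>p \<in> carrier (poly_ring l). f * \<theta> p)\<rparr>"

lemma carrier_Const: "Const c \<in> carrier (poly_ring l)"
  by (simp add: Const_def poly_ring_def)

lemma X_carrier: "j < l \<Longrightarrow> X j \<in> carrier (poly_ring l)"
  by (simp add: X_def poly_ring_def)

lemma module_log_der: "Module.module (poly_ring l) (log_der_module l (A :: 'k::field vec set set))"
proof -
  interpret S: cring "poly_ring l :: 'k mvpoly ring" by (rule cring_poly_ring)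
  let ?S = "poly_ring l :: 'k mvpoly ring"
  have S[simp]: "p \<oplus>\<^bsub>?S\<^esub> q = p + q" "p \<otimes>\<^bsub>?S\<^esub> q = p * q" "\<zero>\<^bsub>?S\<^esub> = 0" "\<one>\<^bsub>?S\<^esub> = 1" for p q
    by (simp_all add: poly_ring_def)
  have clA[simp]: "p + q \<in> carrier ?S" if "p \<in> carrier ?S" "q \<in> carrier ?S" for p q
    using S.add.m_closed[OF that] by simp
  have clM[simp]: "p * q \<in> carrier ?S" if "p \<in> carrier ?S" "q \<in> carrier ?S" for p q
    using S.m_closed[OF that] by simp
  have cl0[simp]: "0 \<in> carrier ?S" "1 \<in> carrier ?S" using S.zero_closed S.one_closed by simp_all
  have clN[simp]: "- p \<in> carrier ?S" if "p \<in> carrier ?S" for p using that by (simp add: poly_ring_def)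
  have C[simp]: "Const c \<in> carrier ?S" for c by (rule carrier_Const)
  have lfc: "linear_form l a \<in> carrier ?S" for a
  proof -
    have "(\<Sum>j\<in>J. Const (a $ j) * X j) \<in> carrier ?S" if "finite J" "J \<subseteq> {..<l}" for J
      using that by induction (auto intro!: clA clM X_carrier)
    then show ?thesis by (auto simp: linear_form_def)
  qed
  have D: "\<theta> \<in> log_der l A \<longleftrightarrow> \<theta> \<in> Der l \<and> (\<forall>H\<in>A. \<forall>p. defines_hyperplane l p H \<longrightarrow> (\<exists>f\<in>carrier ?S. \<theta> p = f * p))" for \<theta>
  proof -
    have "PIdl\<^bsub>?S\<^esub> p = {f * p | f. f \<in> carrier ?S}" for p by (simp add: cgenideal_def)
    then show ?thesis unfolding log_der_def by blast
  qed
  have E: "p \<in> carrier ?S" if "defines_hyperplane l p H" for p H using that lfc by (auto simp: defines_hyperplane_def)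
  have add: "(\<lambda>p\<in>carrier ?S. \<theta> p + \<eta> p) \<in> log_der l A" if t: "\<theta> \<in> log_der l A" "\<eta> \<in> log_der l A" for \<theta> \<eta>
    unfolding D
  proof (intro conjI ballI allI impI)
    show "(\<lambda>p\<in>carrier ?S. \<theta> p + \<eta> p) \<in> Der l"
      using t unfolding D Der_def by (auto simp: algebra_simps PiE_iff)
    fix H p assume "H \<in> A" "defines_hyperplane l p H"
    with t obtain f g where "f \<in> carrier ?S" "g \<in> carrier ?S" "\<theta> p = f * p" "\<eta> p = g * p" unfolding D by blast
    then show "\<exists>f\<in>carrier ?S. (\<lambda>p\<in>carrier ?S. \<theta> p + \<eta> p) p = f * p"
      using E[OF \<open>defines_hyperplane l p H\<close>] by (intro bexI[of _ "f+g"]) (auto simp: algebra_simps)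
  qed
  have sm: "(\<lambda>p\<in>carrier ?S. h * \<theta> p) \<in> log_der l A" if t: "\<theta> \<in> log_der l A" "h \<in> carrier ?S" for \<theta> h
    unfolding D
  proof (intro conjI ballI allI impI)
    show "(\<lambda>p\<in>carrier ?S. h * \<theta> p) \<in> Der l"
      using t unfolding D Der_def by (auto simp: algebra_simps PiE_iff)
    fix H p assume "H \<in> A" "defines_hyperplane l p H"
    with t obtain f where "f \<in> carrier ?S" "\<theta> p = f * p" unfolding D by blast
    then show "\<exists>f\<in>carrier ?S. (\<lambda>p\<in>carrier ?S. h * \<theta> p) p = f * p"
      using t E[OF \<open>defines_hyperplane l p H\<close>] by (intro bexI[of _ "h*f"]) (auto simp: algebra_simps)
  qed
  have z: "(\<lambda>p\<in>carrier ?S. 0) \<in> log_der l A"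
    unfolding D Der_def using E by (auto intro!: bexI[of _ 0])
  have ext: "\<theta> \<in> extensional (carrier ?S)" if "\<theta> \<in> log_der l A" for \<theta>
    using that unfolding D Der_def by (auto simp: PiE_iff)
  show ?thesis
  proof (rule moduleI)
    show "abelian_group (log_der_module l A)"
    proof (rule abelian_groupI)
      fix \<theta> assume "\<theta> \<in> carrier (log_der_module l A)"
      then have t: "\<theta> \<in> log_der l A" by (simp add: log_der_module_def)
      show "\<zero>\<^bsub>log_der_module l A\<^esub> \<oplus>\<^bsub>log_der_module l A\<^esub> \<theta> = \<theta>"
        using ext[OF t] by (auto simp: log_der_module_def fun_eq_iff extensional_def)
      show "\<exists>\<eta>\<in>carrier (log_der_module l A). \<eta> \<oplus>\<^bsub>log_der_module l A\<^esub> \<theta> = \<zero>\<^bsub>log_der_module l A\<^esub>"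
        by (rule bexI[of _ "\<lambda>p\<in>carrier ?S. (-1) * \<theta> p"]) (use sm[OF t, of "-1"] in \<open>auto simp: log_der_module_def fun_eq_iff\<close>)
    qed (auto simp: log_der_module_def add z fun_eq_iff algebra_simps)
  next
    fix \<theta> assume "\<theta> \<in> carrier (log_der_module l A)"
    then have t: "\<theta> \<in> log_der l A" by (simp add: log_der_module_def)
    show "\<one>\<^bsub>?S\<^esub> \<odot>\<^bsub>log_der_module l A\<^esub> \<theta> = \<theta>"
      using ext[OF t] by (auto simp: log_der_module_def fun_eq_iff extensional_def)
  qed (auto simp: log_der_module_def sm cring_poly_ring fun_eq_iff algebra_simps)
qed

text \<open>
  The derivations are numbered \<open>\<theta> 1, \<dots>, \<theta> (l + 1)\<close>, whereas matrix indices start at 0: the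
  row of \<open>\<theta> i\<close> has index \<open>i - 1\<close>.  \<open>insert_index k\<close> enumerates the indices different from \<open>k\<close>.
\<close>

definition coeff_matrix :: "nat \<Rightarrow> (nat \<Rightarrow> 'k::field mvpoly \<Rightarrow> 'k mvpoly) \<Rightarrow> 'k mvpoly mat" where
  "coeff_matrix l \<theta> = mat (l + 1) l (\<lambda>(r, c). \<theta> (r + 1) (X c))"

definition coeff_minor :: "nat \<Rightarrow> (nat \<Rightarrow> 'k::field mvpoly \<Rightarrow> 'k mvpoly) \<Rightarrow> nat \<Rightarrow> 'k mvpoly mat" where
  "coeff_minor l \<theta> i = mat l l (\<lambda>(r, c). coeff_matrix l \<theta> $$ (insert_index (i - 1) r, c))"

text \<open>Strictly plus-one generated arrangements.\<close>

definition SPOG :: "nat \<Rightarrow> 'k::field vec set set \<Rightarrow> bool" where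
  "SPOG l A \<longleftrightarrow> (\<exists>\<theta> f.
     (\<forall>i \<in> {1..l+1}. homogeneous_der l (\<theta> i)) \<and>
     minimal_generators (poly_ring l) (log_der_module l A) {1..l+1} \<theta> \<and>
     unique_relation (poly_ring l) (log_der_module l A) {1..l+1} \<theta> f \<and>
     f (l + 1) \<in> homog_part l 1 - {0})"

end

theory Submission
  imports Defs
begin

text \<open>
  Write \<open>S\<close> for the polynomial ring, \<open>D\<close> for the module of logarithmic derivations and \<open>\<beta> = g (l + 1)\<close>.
  That \<open>g\<close> is a relation is Laplace expansion of a determinant with a repeated column
  (\<open>signed_minors_relation\<close>).  Since \<open>\<theta> 1, \<dots>, \<theta> l\<close> are linearly independent, a relation is determined over
  the fraction field by its last entry, and since the prime \<open>\<beta>\<close> does not divide all the other \<open>g i\<close>, every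
  relation is a multiple of \<open>g\<close> in \<open>S\<close> (\<open>relation_is_multiple_of_g\<close>).  No \<open>g i\<close> is a unit, hence no \<open>\<theta> i\<close>
  is redundant (\<open>\<theta>_minimal_generators\<close>).

  The main point is that the \<open>\<theta> i\<close> generate.  Let \<open>N\<close> be the submodule that they span.  By Cramer's rule,
  and because \<open>Q\<close> divides every determinant of \<open>l\<close> logarithmic derivations (\<open>prod_hyperplanes_dvd_det\<close>),
  each \<open>g i\<close> maps \<open>D\<close> into \<open>N\<close>.  In homological terms, \<open>D / N\<close> is annihilated by the ideal of the \<open>g i\<close>,
  whose grade is at least 3 by the hypothesis on common divisors, whereas \<open>N\<close> has the resolution
  \<open>0 \<rightarrow> S \<rightarrow> S ^ (l + 1) \<rightarrow> N \<rightarrow> 0\<close> and therefore depth at least 2 on that ideal; as \<open>D\<close> is torsion free, this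
  forces \<open>D / N = 0\<close>.

  The proof below carries out this argument by elements (\<open>log_der_in_span\<close>).  For \<open>\<eta>\<close> in \<open>D\<close> it compares the
  combinations of the \<open>\<theta> i\<close> that equal \<open>\<beta> * \<eta>\<close> and \<open>g k * \<eta>\<close>.  Modulo \<open>\<beta>\<close> the coefficients of the first one
  turn out to be proportional to \<open>g\<close>.  The quotient of \<open>S\<close> by \<open>\<beta>\<close> is again a polynomial ring, hence factorial,
  and \<open>g\<close> is primitive there, so the coefficients are a multiple of \<open>g\<close> modulo \<open>\<beta>\<close>
  (\<open>proportional_mod_linear\<close>).  Subtracting this multiple of the relation makes all coefficients divisible
  by \<open>\<beta>\<close>, and \<open>\<beta>\<close> can be cancelled.  The primes needed here must be homogeneous in order to be common
  divisors in the sense of the hypothesis; this holds because the \<open>g i\<close> are homogeneous and divisors of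
  homogeneous polynomials are homogeneous.  Factoriality of polynomial rings is
  \<open>exists_prime_in_divisor\<close>.
\<close>

section \<open>Polynomials in a prescribed set of variables\<close>

text \<open>
  Arbitrary sets of variables are needed because factoriality is proved by adding one variable at a
  time, and because reducing modulo a linear form removes a variable that need not be the last one.
\<close>

definition polys_in :: "nat set \<Rightarrow> 'k::field mvpoly set" where
  "polys_in V = {p. \<forall>m \<in> Poly_Mapping.keys p. Poly_Mapping.keys m \<subseteq> V}"

lemma carrier_poly_ring: "carrier (poly_ring l) = polys_in {..<l}"
  by (simp add: poly_ring_def polys_in_def)

lemma polys_in_mono: "V \<subseteq> W \<Longrightarrow> polys_in V \<subseteq> polys_in W"
  by (auto simp: polys_in_def)

lemma polys_in_0 [simp]: "0 \<in> polys_in V"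
  and polys_in_1 [simp]: "1 \<in> polys_in V"
  and polys_in_Const [simp]: "Const c \<in> polys_in V"
  and polys_in_X: "j \<in> V \<Longrightarrow> X j \<in> polys_in V"
  and polys_in_uminus [simp]: "- p \<in> polys_in V \<longleftrightarrow> p \<in> polys_in V"
  by (simp_all add: polys_in_def Const_def X_def)

lemma polys_in_add [simp]: "p \<in> polys_in V \<Longrightarrow> q \<in> polys_in V \<Longrightarrow> p + q \<in> polys_in V"
  using Poly_Mapping.keys_add[of p q] by (fastforce simp: polys_in_def)

lemma polys_in_diff [simp]: "p \<in> polys_in V \<Longrightarrow> q \<in> polys_in V \<Longrightarrow> p - q \<in> polys_in V"
  using polys_in_add[of p V "- q"] by simp

lemma polys_in_mult [simp]: "p \<in> polys_in V \<Longrightarrow> q \<in> polys_in V \<Longrightarrow> p * q \<in> polys_in V"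
proof -
  assume p: "p \<in> polys_in V" and q: "q \<in> polys_in V"
  have "Poly_Mapping.keys m \<subseteq> V" if m: "m \<in> Poly_Mapping.keys (p * q)" for m
  proof -
    obtain a b where ab: "m = a + b" "a \<in> Poly_Mapping.keys p" "b \<in> Poly_Mapping.keys q"
      using m keys_mult[of p q] by blast
    then show ?thesis
      using p q Poly_Mapping.keys_add[of a b] unfolding polys_in_def by blast
  qed
  then show ?thesis by (simp add: polys_in_def)
qed

lemma polys_in_sum: "(\<And>i. i \<in> I \<Longrightarrow> f i \<in> polys_in V) \<Longrightarrow> (\<Sum>i\<in>I. f i) \<in> polys_in V"
  by (induction I rule: infinite_finite_induct) auto

lemma polys_in_prod: "(\<And>i. i \<in> I \<Longrightarrow> f i \<in> polys_in V) \<Longrightarrow> (\<Prod>i\<in>I. f i) \<in> polys_in V"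
  by (induction I rule: infinite_finite_induct) auto

lemma polys_in_power [simp]: "p \<in> polys_in V \<Longrightarrow> p ^ n \<in> polys_in V"
  by (induction n) auto

lemma Const_simps [simp]:
  "Const 0 = 0" "Const 1 = 1" "Const (a + b) = Const a + Const b"
  "Const (a * b) = Const a * Const b"
  by (simp_all add: Const_def single_add mult_single)

lemma Const_eq_0_iff [simp]: "Const c = 0 \<longleftrightarrow> c = 0"
  unfolding Const_def by (metis lookup_single_eq lookup_zero single_zero)

lemma sum_single_keys: "p = (\<Sum>m \<in> Poly_Mapping.keys p. Poly_Mapping.single m (Poly_Mapping.lookup p m))"
  by (rule poly_mapping_eqI)
    (auto simp: lookup_sum lookup_single when_def in_keys_iff)

lemma single_sum_monomial:
  "finite J \<Longrightarrow> Poly_Mapping.single (\<Sum>j\<in>J. f j) (1::'k::field) = (\<Prod>j\<in>J. Poly_Mapping.single (f j) 1)"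
proof (induction J rule: finite_induct)
  case (insert x F)
  then show ?case by (simp flip: insert.IH add: mult_single)
qed simp

lemma X_power: "X j ^ n = Poly_Mapping.single (Poly_Mapping.single j n) (1::'k::field)"
  by (induction n) (simp_all add: X_def mult_single flip: single_add)

lemma polynomial_expansion:
  "p = (\<Sum>m \<in> Poly_Mapping.keys p. Const (Poly_Mapping.lookup p m) *
          (\<Prod>j \<in> Poly_Mapping.keys m. X j ^ Poly_Mapping.lookup m j))"
proof -
  have "Poly_Mapping.single m c = Const c * (\<Prod>j \<in> Poly_Mapping.keys m. X j ^ Poly_Mapping.lookup m j)"
    for m and c :: 'a
    by (simp add: X_power mult_single Const_def flip: single_sum_monomial sum_single_keys)
  then show ?thesis using sum_single_keys[of p] by simp
qed

text \<open>
  The polynomials in the variables \<open>V\<close> are generated as a ring by the constants and the variables, so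
  a property of them can be checked on generators, sums and products.
\<close>

lemma polys_in_induct [consumes 1, case_names Const X add mult]:
  assumes "p \<in> polys_in V"
    and C: "\<And>c. P (Const c)"
    and X: "\<And>j. j \<in> V \<Longrightarrow> P (X j)"
    and A: "\<And>p q. p \<in> polys_in V \<Longrightarrow> q \<in> polys_in V \<Longrightarrow> P p \<Longrightarrow> P q \<Longrightarrow> P (p + q)"
    and M: "\<And>p q. p \<in> polys_in V \<Longrightarrow> q \<in> polys_in V \<Longrightarrow> P p \<Longrightarrow> P q \<Longrightarrow> P (p * q)"
  shows "P p"
proof -
  let ?P = "\<lambda>p. p \<in> polys_in V \<and> P p"
  have C0: "?P 0" "?P 1" using C[of 0] C[of 1] by simp_all
  have sum: "?P (\<Sum>i\<in>I. f i)" if "\<And>i. i \<in> I \<Longrightarrow> ?P (f i)" for I :: "(nat \<Rightarrow>\<^sub>0 nat) set" and f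
    using that by (induction I rule: infinite_finite_induct) (use C0 A in auto)
  have prod: "?P (\<Prod>i\<in>I. f i)" if "\<And>i. i \<in> I \<Longrightarrow> ?P (f i)" for I :: "nat set" and f
    using that by (induction I rule: infinite_finite_induct) (use C0 M in auto)
  have pow: "?P (X j ^ n)" if "j \<in> V" for j n
    using that by (induction n) (use C0 M X in \<open>auto simp: polys_in_X\<close>)
  have "?P (\<Sum>m \<in> Poly_Mapping.keys p. Const (Poly_Mapping.lookup p m) *
          (\<Prod>j \<in> Poly_Mapping.keys m. X j ^ Poly_Mapping.lookup m j))"
  proof (rule sum)
    fix m assume "m \<in> Poly_Mapping.keys p"
    then have "?P (\<Prod>j \<in> Poly_Mapping.keys m. X j ^ Poly_Mapping.lookup m j)"
      using assms(1) by (intro prod pow) (auto simp: polys_in_def)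
    then show "?P (Const (Poly_Mapping.lookup p m) * (\<Prod>j \<in> Poly_Mapping.keys m. X j ^ Poly_Mapping.lookup m j))"
      using C M by simp
  qed
  then show ?thesis by (simp flip: polynomial_expansion)
qed

section \<open>Polynomials as polynomials in one distinguished variable\<close>

text \<open>
  The \<open>K\<close>-linear extension of a map defined on monomials.  If \<open>f\<close> turns sums of exponent vectors into
  products, this is a ring homomorphism into polynomials in one auxiliary variable \<open>t\<close>.  Two choices of
  \<open>f\<close> matter: one lets \<open>t\<close> record the exponent of a single variable, the other the total degree.  In
  both cases a value of \<open>t\<close> recovers the polynomial, so that the homomorphism is injective and degrees
  in \<open>t\<close> are additive on products.
\<close>

definition monomial_extension ::
  "((nat \<Rightarrow>\<^sub>0 nat) \<Rightarrow> 'k::field mvpoly poly) \<Rightarrow> 'k mvpoly \<Rightarrow> 'k mvpoly poly" where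
  "monomial_extension f p =
     (\<Sum>m \<in> Poly_Mapping.keys p. smult (Const (Poly_Mapping.lookup p m)) (f m))"

lemma monomial_extension_superset:
  assumes "finite K" "Poly_Mapping.keys p \<subseteq> K"
  shows "monomial_extension f p = (\<Sum>m \<in> K. smult (Const (Poly_Mapping.lookup p m)) (f m))"
  unfolding monomial_extension_def using assms
  by (intro sum.mono_neutral_left) (auto simp: in_keys_iff)

lemma monomial_extension_0 [simp]: "monomial_extension f 0 = 0"
  by (simp add: monomial_extension_def)

lemma monomial_extension_single [simp]:
  "monomial_extension f (Poly_Mapping.single m c) = smult (Const c) (f m)"
  by (simp add: monomial_extension_superset[of "{m}"])

lemma monomial_extension_add:
  "monomial_extension f (p + q) = monomial_extension f p + monomial_extension f q"
  using Poly_Mapping.keys_add[of p q]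
  by (simp add: monomial_extension_superset[of "Poly_Mapping.keys p \<union> Poly_Mapping.keys q"]
      lookup_add smult_add_left sum.distrib)

lemma monomial_extension_sum:
  "monomial_extension f (\<Sum>i\<in>I. p i) = (\<Sum>i\<in>I. monomial_extension f (p i))"
  by (induction I rule: infinite_finite_induct) (simp_all add: monomial_extension_add)

lemma monomial_extension_mult:
  assumes "\<And>m n. f (m + n) = f m * f n"
  shows "monomial_extension f (p * q) = monomial_extension f p * monomial_extension f q"
proof -
  let ?s = "\<lambda>p m. Poly_Mapping.single m (Poly_Mapping.lookup p m)"
  have "p * q = (\<Sum>m \<in> Poly_Mapping.keys p. \<Sum>n \<in> Poly_Mapping.keys q. ?s p m * ?s q n)"
    by (subst sum_single_keys[of p], subst sum_single_keys[of q]) (rule sum_product)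
  then show ?thesis
    by (simp add: monomial_extension_sum mult_single assms)
      (simp add: monomial_extension_def sum_product mult_ac)
qed

lemma monomial_extension_Const: "f 0 = 1 \<Longrightarrow> monomial_extension f (Const c) = [:Const c:]"
  by (simp add: Const_def flip: one_pCons)

lemma poly_monomial_extension:
  assumes "\<And>m. poly (f m) t = Poly_Mapping.single m 1"
  shows "poly (monomial_extension f p) t = p"
proof -
  have "poly (monomial_extension f p) t
      = (\<Sum>m\<in>Poly_Mapping.keys p. Poly_Mapping.single m (Poly_Mapping.lookup p m))"
    by (simp add: monomial_extension_def assms poly_sum Const_def mult_single)
  then show ?thesis by (simp flip: sum_single_keys)
qed

text \<open>
  Keeping the coefficients, which do not involve \<open>X x\<close>, in the type of the polynomial itself lets the
  construction be used for every variable in turn.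
\<close>

definition univariate :: "nat \<Rightarrow> 'k::field mvpoly \<Rightarrow> 'k mvpoly poly" where
  "univariate x = monomial_extension
     (\<lambda>m. monom (Poly_Mapping.single (Poly_Mapping.update x 0 m) 1) (Poly_Mapping.lookup m x))"

lemma univariate_0 [simp]: "univariate x 0 = 0"
  by (simp add: univariate_def)

lemma univariate_add: "univariate x (p + q) = univariate x p + univariate x q"
  by (simp add: univariate_def monomial_extension_add)

lemma univariate_mult: "univariate x (p * q) = univariate x p * univariate x q"
proof -
  have "Poly_Mapping.update x 0 (m + n) = Poly_Mapping.update x 0 m + Poly_Mapping.update x 0 n"
    for m n :: "nat \<Rightarrow>\<^sub>0 nat"
    by (rule poly_mapping_eqI) (simp add: lookup_update lookup_add)
  then show ?thesis
    unfolding univariate_def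
    by (intro monomial_extension_mult) (simp add: mult_monom mult_single lookup_add)
qed

lemma univariate_uminus: "univariate x (- p) = - univariate x p"
  using univariate_add[of x p "- p"] by (simp add: add_eq_0_iff2)

lemma univariate_diff: "univariate x (p - q) = univariate x p - univariate x q"
  using univariate_add[of x p "- q"] by (simp add: univariate_uminus)

lemma poly_univariate [simp]: "poly (univariate x p) (X x) = p"
  unfolding univariate_def
proof (rule poly_monomial_extension)
  fix m :: "nat \<Rightarrow>\<^sub>0 nat"
  have "Poly_Mapping.update x 0 m + Poly_Mapping.single x (Poly_Mapping.lookup m x) = m"
    by (rule poly_mapping_eqI) (simp add: lookup_update lookup_add lookup_single when_def)
  then show "poly (monom (Poly_Mapping.single (Poly_Mapping.update x 0 m) (1::'a)) (Poly_Mapping.lookup m x)) (X x)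
      = Poly_Mapping.single m 1"
    by (simp add: poly_monom X_power mult_single)
qed

lemma univariate_eq_0_iff [simp]: "univariate x p = 0 \<longleftrightarrow> p = 0"
  by (metis poly_0 poly_univariate univariate_0)

lemma univariate_Const: "univariate x (Const c) = [:Const c:]"
proof -
  have "Poly_Mapping.update x 0 (0 :: nat \<Rightarrow>\<^sub>0 nat) = 0"
    by (rule poly_mapping_eqI) (simp add: lookup_update)
  then show ?thesis
    unfolding univariate_def by (intro monomial_extension_Const) simp
qed

lemma univariate_X: "univariate x (X j) = (if j = x then monom 1 1 else [:X j:])"
proof -
  have "Poly_Mapping.update j 0 (Poly_Mapping.single j 1 :: nat \<Rightarrow>\<^sub>0 nat) = 0"
    by (rule poly_mapping_eqI) (simp add: lookup_update lookup_single when_def)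
  moreover have "Poly_Mapping.update x 0 (Poly_Mapping.single j 1 :: nat \<Rightarrow>\<^sub>0 nat) = Poly_Mapping.single j 1" if "j \<noteq> x"
    using that by (intro poly_mapping_eqI) (simp add: lookup_update lookup_single when_def)
  ultimately show ?thesis
    by (auto simp: univariate_def X_def monom_0 lookup_single)
qed

lemma univariate_free:
  assumes "p \<in> polys_in V" "x \<notin> V"
  shows "univariate x p = [:p:]"
  using assms(1)
proof (induction rule: polys_in_induct)
  case (X j)
  then show ?case using assms(2) by (auto simp: univariate_X)
qed (simp_all add: univariate_Const univariate_add univariate_mult mult.commute)

lemma coeff_univariate_in:
  assumes "p \<in> polys_in (insert x V)"
  shows "coeff (univariate x p) i \<in> polys_in V"
proof -
  have "Poly_Mapping.single (Poly_Mapping.update x 0 m) (1::'a) \<in> polys_in V"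
    if "m \<in> Poly_Mapping.keys p" for m
    using that assms by (auto simp: polys_in_def keys_update)
  then show ?thesis
    unfolding univariate_def monomial_extension_def coeff_sum coeff_smult coeff_monom
    by (intro polys_in_sum) auto
qed

definition degree_in :: "nat \<Rightarrow> 'k::field mvpoly \<Rightarrow> nat" where
  "degree_in x p = degree (univariate x p)"

lemma degree_in_mult: "p \<noteq> 0 \<Longrightarrow> q \<noteq> 0 \<Longrightarrow> degree_in x (p * q) = degree_in x p + degree_in x q"
  by (simp add: degree_in_def univariate_mult degree_mult_eq)

lemma degree_in_free: "p \<in> polys_in V \<Longrightarrow> x \<notin> V \<Longrightarrow> degree_in x p = 0"
  by (simp add: degree_in_def univariate_free)

lemma degree_in_eq_0:
  assumes "p \<in> polys_in (insert x V)" "degree_in x p = 0"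
  shows "p \<in> polys_in V"
proof -
  obtain c where c: "univariate x p = [:c:]"
    using assms(2) by (auto simp: degree_in_def elim: degree_eq_zeroE)
  then have "p = c" using poly_univariate[of x p] by simp
  then show ?thesis using coeff_univariate_in[OF assms(1), of 0] c by simp
qed

text \<open>
  The degree in each variable is additive on products.  A variable that is absent from a nonzero product
  is therefore absent from its factors.  Hence divisibility in the ring of all polynomials between
  elements of a subring \<open>polys_in V\<close> is divisibility in the subring.
\<close>

lemma polys_in_divisor:
  assumes "p * q \<in> polys_in V" "p * q \<noteq> 0"
  shows "p \<in> polys_in V"
proof -
  have "p \<in> polys_in (- {x})" if "x \<notin> V" for x
  proof (rule degree_in_eq_0)
    show "p \<in> polys_in (insert x (- {x}))" by (auto simp: polys_in_def)
    show "degree_in x p = 0"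
      using degree_in_free[OF assms(1) that] assms(2) by (auto simp: degree_in_mult)
  qed
  then show ?thesis unfolding polys_in_def by blast
qed

lemma polys_in_cofactor:
  "p * q \<in> polys_in V \<Longrightarrow> p * q \<noteq> 0 \<Longrightarrow> q \<in> polys_in V"
  using polys_in_divisor[of q p V] by (simp add: mult.commute)

lemma polys_in_quotient:
  assumes "a * b \<in> polys_in V" "a \<noteq> 0"
  shows "b \<in> polys_in V"
  using assms polys_in_cofactor[of a b V] by (cases "b = 0") auto

section \<open>Homogeneous components\<close>

lemma mon_deg_superset:
  "finite J \<Longrightarrow> Poly_Mapping.keys m \<subseteq> J \<Longrightarrow> mon_deg m = (\<Sum>j\<in>J. Poly_Mapping.lookup m j)"
  unfolding mon_deg_def by (intro sum.mono_neutral_left) (auto simp: in_keys_iff)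

lemma mon_deg_0 [simp]: "mon_deg 0 = 0"
  by (simp add: mon_deg_def)

lemma mon_deg_add: "mon_deg (m + n) = mon_deg m + mon_deg n"
  using Poly_Mapping.keys_add[of m n]
  by (simp add: mon_deg_superset[of "Poly_Mapping.keys m \<union> Poly_Mapping.keys n"]
      lookup_add sum.distrib)

lemma mon_deg_eq_0_iff: "mon_deg m = 0 \<longleftrightarrow> m = 0"
  by (auto simp: mon_deg_def in_keys_iff) (metis in_keys_iff keys_eq_empty ex_in_conv poly_mapping_eqI lookup_zero)

text \<open>
  The homomorphism \<open>p(X) \<mapsto> p(t X)\<close>; its coefficient at \<open>t ^ d\<close> is the homogeneous component of degree
  \<open>d\<close>.
\<close>

definition grading :: "'k::field mvpoly \<Rightarrow> 'k mvpoly poly" where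
  "grading = monomial_extension (\<lambda>m. monom (Poly_Mapping.single m 1) (mon_deg m))"

lemma grading_0 [simp]: "grading 0 = 0"
  by (simp add: grading_def)

lemma grading_add: "grading (p + q) = grading p + grading q"
  by (simp add: grading_def monomial_extension_add)

lemma grading_mult: "grading (p * q) = grading p * grading q"
  unfolding grading_def
  by (intro monomial_extension_mult) (simp add: mult_monom mult_single mon_deg_add)

lemma poly_grading [simp]: "poly (grading p) 1 = p"
  unfolding grading_def by (rule poly_monomial_extension) (simp add: poly_monom)

lemma grading_eq_0_iff [simp]: "grading p = 0 \<longleftrightarrow> p = 0"
  by (metis poly_0 poly_grading grading_0)

lemma lookup_coeff_grading:
  "Poly_Mapping.lookup (coeff (grading p) d) m = (if mon_deg m = d then Poly_Mapping.lookup p m else 0)"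
proof -
  have "coeff (grading p) d =
      (\<Sum>n\<in>Poly_Mapping.keys p. if mon_deg n = d then Poly_Mapping.single n (Poly_Mapping.lookup p n) else 0)"
    unfolding grading_def monomial_extension_def coeff_sum
    by (intro sum.cong) (auto simp: Const_def mult_single)
  also have "Poly_Mapping.lookup \<dots> m =
      (\<Sum>n\<in>Poly_Mapping.keys p. if n = m then (if mon_deg m = d then Poly_Mapping.lookup p m else 0) else 0)"
    unfolding lookup_sum by (intro sum.cong) (auto simp: lookup_single when_def)
  also have "\<dots> = (if mon_deg m = d then Poly_Mapping.lookup p m else 0)"
    by (auto simp: in_keys_iff)
  finally show ?thesis .
qed

lemma coeff_grading_in: "p \<in> polys_in V \<Longrightarrow> coeff (grading p) d \<in> polys_in V"
  unfolding polys_in_def by (auto simp: in_keys_iff lookup_coeff_grading split: if_splits)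

definition homogeneous :: "nat \<Rightarrow> 'k::field mvpoly \<Rightarrow> bool" where
  "homogeneous d p \<longleftrightarrow> (\<forall>m \<in> Poly_Mapping.keys p. mon_deg m = d)"

lemma homogeneous_iff_grading: "homogeneous d p \<longleftrightarrow> grading p = monom p d"
proof
  assume "homogeneous d p"
  then show "grading p = monom p d"
    by (intro poly_eqI poly_mapping_eqI)
      (auto simp: lookup_coeff_grading homogeneous_def in_keys_iff)
next
  assume g: "grading p = monom p d"
  show "homogeneous d p"
    unfolding homogeneous_def
  proof
    fix m assume "m \<in> Poly_Mapping.keys p"
    then show "mon_deg m = d"
      using lookup_coeff_grading[of p "mon_deg m" m] g by (auto simp: in_keys_iff split: if_splits)
  qed
qed

lemma homogeneous_0 [simp]: "homogeneous d 0"
  by (simp add: homogeneous_def)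

lemma homogeneous_one: "homogeneous 0 1"
  by (simp add: homogeneous_def)

lemma homogeneous_uminus [simp]: "homogeneous d (- p) \<longleftrightarrow> homogeneous d p"
  by (simp add: homogeneous_def)

lemma homogeneous_add: "homogeneous d p \<Longrightarrow> homogeneous d q \<Longrightarrow> homogeneous d (p + q)"
  by (simp add: homogeneous_iff_grading grading_add add_monom)

lemma homogeneous_mult: "homogeneous d p \<Longrightarrow> homogeneous e q \<Longrightarrow> homogeneous (d + e) (p * q)"
  by (simp add: homogeneous_iff_grading grading_mult mult_monom)

lemma homogeneous_sum: "(\<And>i. i \<in> I \<Longrightarrow> homogeneous d (f i)) \<Longrightarrow> homogeneous d (\<Sum>i\<in>I. f i)"
  by (induction I rule: infinite_finite_induct) (auto intro: homogeneous_add)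

lemma homogeneous_prod:
  "(\<And>i. i \<in> I \<Longrightarrow> homogeneous (d i) (f i)) \<Longrightarrow> homogeneous (\<Sum>i\<in>I. d i) (\<Prod>i\<in>I. f i)"
  by (induction I rule: infinite_finite_induct) (auto intro: homogeneous_mult homogeneous_one)

text \<open>
  Over a domain both the degree and the order of vanishing at 0 are additive.  They agree for the
  product, and the order is at most the degree for each factor, so they agree for each factor.
\<close>

lemma dvd_monom_imp_monom:
  fixes P Q :: "'a::idom poly"
  assumes "P * Q = monom c d" "c \<noteq> 0"
  shows "P = monom (lead_coeff P) (degree P)"
proof -
  have nz: "P \<noteq> 0" "Q \<noteq> 0" "P * Q \<noteq> 0" using assms by auto
  have "order 0 P + order 0 Q = degree P + degree Q"
    using order_mult[OF nz(3), of 0] degree_mult_eq[OF nz(1,2)] assms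
    by (simp add: order_0_monom degree_monom_eq)
  then have ord: "order 0 P = degree P"
    using order_degree[OF nz(1), of 0] order_degree[OF nz(2), of 0] by linarith
  have "coeff P i = 0" if "i < degree P" for i
    using that nz(1) ord by (metis le_refl monom_1_dvd_iff monom_1_dvd_iff')
  then show ?thesis
    by (intro poly_eqI) (metis coeff_eq_0 coeff_monom linorder_neqE_nat)
qed

text \<open>
  Homogeneous polynomials are those that \<^const>\<open>grading\<close> maps to a monomial in \<open>t\<close>, and over a
  domain factors of monomials are monomials.
\<close>

lemma homogeneous_divisor:
  assumes "homogeneous d (p * q)" "p * q \<noteq> 0"
  shows "\<exists>e. homogeneous e p"
proof -
  have "grading p * grading q = monom (p * q) d"
    using assms(1) by (simp add: homogeneous_iff_grading flip: grading_mult)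
  from dvd_monom_imp_monom[OF this assms(2)]
  have g: "grading p = monom (lead_coeff (grading p)) (degree (grading p))" .
  then have "p = lead_coeff (grading p)"
    using poly_grading[of p] by (metis poly_monom power_one mult.right_neutral)
  with g show ?thesis by (metis homogeneous_iff_grading)
qed

definition total_degree :: "'k::field mvpoly \<Rightarrow> nat" where
  "total_degree p = degree (grading p)"

lemma total_degree_mult:
  "p \<noteq> 0 \<Longrightarrow> q \<noteq> 0 \<Longrightarrow> total_degree (p * q) = total_degree p + total_degree q"
  by (simp add: total_degree_def grading_mult degree_mult_eq)

lemma homogeneous_0_imp_Const: "homogeneous 0 p \<Longrightarrow> p = Const (Poly_Mapping.lookup p 0)"
  by (rule poly_mapping_eqI)
    (auto simp: homogeneous_def Const_def lookup_single when_def mon_deg_eq_0_iff in_keys_iff)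

lemma Const_mult_inverse: "c \<noteq> 0 \<Longrightarrow> Const (1 / c) * Const c = 1"
  by (simp flip: Const_simps(4))

lemma is_unit_if_homogeneous_0:
  assumes "homogeneous 0 p" "p \<noteq> 0"
  shows "p dvd 1"
proof -
  define c where "c = Poly_Mapping.lookup p 0"
  have p: "p = Const c" unfolding c_def by (rule homogeneous_0_imp_Const[OF assms(1)])
  then have "c \<noteq> 0" using assms(2) by auto
  from Const_mult_inverse[OF this] have "1 = p * Const (1 / c)" unfolding p by (metis mult.commute)
  then show ?thesis by (rule dvdI)
qed

lemma is_unit_if_total_degree_0:
  assumes "total_degree p = 0" "p \<noteq> 0"
  shows "p dvd 1"
proof -
  obtain c where c: "grading p = [:c:]"
    using assms(1) by (auto simp: total_degree_def elim: degree_eq_zeroE)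
  then have "p = c" using poly_grading[of p] by simp
  with c have "homogeneous 0 p" by (simp add: homogeneous_iff_grading monom_0)
  then show ?thesis using assms(2) by (rule is_unit_if_homogeneous_0)
qed

section \<open>Existence of prime divisors\<close>

text \<open>
  Primality is relative to \<open>polys_in V\<close>, since the induction on \<open>V\<close> below needs primes of the smaller
  ring; divisibility may be taken in the ambient type by \<open>polys_in_divisor\<close>.
\<close>

definition prime_in :: "nat set \<Rightarrow> 'k::field mvpoly \<Rightarrow> bool" where
  "prime_in V \<pi> \<longleftrightarrow> \<pi> \<in> polys_in V \<and> \<pi> \<noteq> 0 \<and> \<not> \<pi> dvd 1 \<and>
     (\<forall>a \<in> polys_in V. \<forall>b \<in> polys_in V. \<pi> dvd a * b \<longrightarrow> \<pi> dvd a \<or> \<pi> dvd b)"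

lemma prime_in_not_0: "prime_in V \<pi> \<Longrightarrow> \<pi> \<noteq> 0"
  by (simp add: prime_in_def)

lemma prime_in_carrier: "prime_in V \<pi> \<Longrightarrow> \<pi> \<in> polys_in V"
  by (simp add: prime_in_def)

lemma prime_in_dvd_multD:
  "prime_in V \<pi> \<Longrightarrow> \<pi> dvd a * b \<Longrightarrow> a \<in> polys_in V \<Longrightarrow> b \<in> polys_in V \<Longrightarrow> \<pi> dvd a \<or> \<pi> dvd b"
  by (auto simp: prime_in_def)

lemma total_degree_prime_in: "prime_in V \<pi> \<Longrightarrow> total_degree \<pi> > 0"
  using is_unit_if_total_degree_0 by (auto simp: prime_in_def)

text \<open>
  Gauss' argument: if a prime \<open>\<pi>\<close> of the coefficient ring divides neither \<open>a\<close> nor \<open>b\<close>, take the lowest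
  coefficients of \<open>a\<close> and \<open>b\<close> in the new variable, in positions \<open>i\<close> and \<open>j\<close>, that \<open>\<pi>\<close> does not divide.
  Modulo \<open>\<pi>\<close> the coefficient of \<open>a * b\<close> in position \<open>i + j\<close> is their product, which is not zero.
\<close>

lemma prime_in_insert:
  assumes \<pi>: "prime_in V \<pi>" and x: "x \<notin> V"
  shows "prime_in (insert x V) \<pi>"
proof -
  have u: "univariate x \<pi> = [:\<pi>:]"
    using univariate_free[OF prime_in_carrier[OF \<pi>] x] .
  have dvd_iff: "\<pi> dvd p \<longleftrightarrow> (\<forall>i. \<pi> dvd coeff (univariate x p) i)" for p
  proof
    assume "\<pi> dvd p"
    then show "\<forall>i. \<pi> dvd coeff (univariate x p) i"
      by (auto simp: dvd_def univariate_mult u)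
  next
    assume "\<forall>i. \<pi> dvd coeff (univariate x p) i"
    then have "[:\<pi>:] dvd univariate x p" by (simp add: const_poly_dvd_iff)
    then obtain r where "univariate x p = [:\<pi>:] * r" unfolding dvd_def by blast
    from arg_cong[OF this, of "\<lambda>P. poly P (X x)"] have "p = \<pi> * poly r (X x)" by simp
    then show "\<pi> dvd p" by (rule dvdI)
  qed
  have "\<pi> dvd a \<or> \<pi> dvd b"
    if ab: "a \<in> polys_in (insert x V)" "b \<in> polys_in (insert x V)" "\<pi> dvd a * b" for a b
  proof (rule ccontr)
    assume neg: "\<not> (\<pi> dvd a \<or> \<pi> dvd b)"
    let ?a = "coeff (univariate x a)" and ?b = "coeff (univariate x b)"
    have "\<exists>i. \<not> \<pi> dvd ?a i \<and> (\<forall>k<i. \<pi> dvd ?a k)"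
      using neg dvd_iff[of a] exists_least_iff[of "\<lambda>i. \<not> \<pi> dvd ?a i"] by blast
    then obtain i where i: "\<not> \<pi> dvd ?a i" "\<And>k. k < i \<Longrightarrow> \<pi> dvd ?a k" by blast
    have "\<exists>j. \<not> \<pi> dvd ?b j \<and> (\<forall>k<j. \<pi> dvd ?b k)"
      using neg dvd_iff[of b] exists_least_iff[of "\<lambda>i. \<not> \<pi> dvd ?b i"] by blast
    then obtain j where j: "\<not> \<pi> dvd ?b j" "\<And>k. k < j \<Longrightarrow> \<pi> dvd ?b k" by blast
    have "\<pi> dvd coeff (univariate x (a * b)) (i + j)"
      using ab(3) dvd_iff by blast
    also have "coeff (univariate x (a * b)) (i + j) = (\<Sum>k\<le>i + j. ?a k * ?b (i + j - k))"
      by (simp add: univariate_mult coeff_mult)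
    also have "\<dots> = ?a i * ?b j + (\<Sum>k\<in>{..i + j} - {i}. ?a k * ?b (i + j - k))"
      by (subst sum.remove[of _ i]) auto
    finally have "\<pi> dvd ?a i * ?b j + (\<Sum>k\<in>{..i + j} - {i}. ?a k * ?b (i + j - k))" .
    moreover have "\<pi> dvd (\<Sum>k\<in>{..i + j} - {i}. ?a k * ?b (i + j - k))"
    proof (rule dvd_sum)
      fix k assume "k \<in> {..i + j} - {i}"
      then have "k < i \<or> i + j - k < j" by auto
      then show "\<pi> dvd ?a k * ?b (i + j - k)" using i(2) j(2) by auto
    qed
    ultimately have "\<pi> dvd ?a i * ?b j" by (simp add: dvd_add_left_iff)
    then show False
      using prime_in_dvd_multD[OF \<pi>] coeff_univariate_in[OF ab(1)] coeff_univariate_in[OF ab(2)] i(1) j(1)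
      by blast
  qed
  then show ?thesis
    using \<pi> polys_in_mono[of V "insert x V"] by (auto simp: prime_in_def)
qed

text \<open>
  Division with remainder with respect to one variable; multiplying \<open>f\<close> by powers of the leading
  coefficient of \<open>d\<close> avoids fractions.
\<close>

lemma pseudo_division:
  assumes x: "x \<notin> V" and d: "d \<in> polys_in (insert x V)" "d \<noteq> 0"
    and f: "f \<in> polys_in (insert x V)"
  obtains s q where "s \<in> polys_in V" "s \<noteq> 0" "q \<in> polys_in (insert x V)"
    "s * f - d * q = 0 \<or> degree_in x (s * f - d * q) < degree_in x d"
proof -
  have sub: "p \<in> polys_in (insert x V)" if "p \<in> polys_in V" for p :: "'a mvpoly"
    using that polys_in_mono[of V "insert x V"] by blast
  have "\<exists>s q. s \<in> polys_in V \<and> s \<noteq> 0 \<and> q \<in> polys_in (insert x V) \<and>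
      (s * f - d * q = 0 \<or> degree_in x (s * f - d * q) < degree_in x d)"
    using f
  proof (induction "degree_in x f" arbitrary: f rule: less_induct)
    case less
    show ?case
    proof (cases "f = 0 \<or> degree_in x f < degree_in x d")
      case True
      then show ?thesis by (intro exI[of _ 1] exI[of _ 0]) auto
    next
      case False
      define n where "n = degree_in x f - degree_in x d"
      define e where "e = lead_coeff (univariate x d)"
      define c where "c = lead_coeff (univariate x f)"
      define f' where "f' = e * f - d * (c * X x ^ n)"
      have ec: "e \<in> polys_in V" "e \<noteq> 0" "c \<in> polys_in V"
        using coeff_univariate_in d less.prems by (auto simp: e_def c_def)
      have Xn: "univariate x (X x ^ n) = monom (1::'a mvpoly) n"
        by (induction n) (auto simp: univariate_mult univariate_X mult_monom
            univariate_Const[of x 1, simplified])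
      have f'_in: "f' \<in> polys_in (insert x V)"
        using ec d less.prems sub unfolding f'_def
        by (intro polys_in_diff polys_in_mult polys_in_power polys_in_X) auto
      have u: "univariate x f' = smult e (univariate x f) - monom c n * univariate x d"
        unfolding f'_def univariate_diff univariate_mult Xn
        using univariate_free[OF ec(1) x] univariate_free[OF ec(3) x]
        by (simp add: smult_monom)
      have "degree (univariate x f') \<le> degree_in x f"
        unfolding u
      proof (rule degree_diff_le)
        show "degree (smult e (univariate x f)) \<le> degree_in x f"
          by (simp add: degree_in_def)
        show "degree (monom c n * univariate x d) \<le> degree_in x f"
          using degree_mult_le[of "monom c n" "univariate x d"] degree_monom_le[of c n] False
          unfolding n_def degree_in_def by linarith
      qed
      moreover have "coeff (univariate x f') (degree_in x f) = 0"
      proof -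
        have "coeff (monom c n * univariate x d) (n + degree_in x d) = c * e"
          by (simp add: coeff_monom_mult e_def degree_in_def)
        moreover have "n + degree_in x d = degree_in x f" using False by (simp add: n_def)
        ultimately show ?thesis by (simp add: u c_def degree_in_def mult.commute)
      qed
      ultimately have f': "f' = 0 \<or> degree_in x f' < degree_in x f"
        using eq_zero_or_degree_less[of "univariate x f'" "degree_in x f"]
        by (auto simp: degree_in_def)
      obtain s q where sq: "s \<in> polys_in V" "s \<noteq> 0" "q \<in> polys_in (insert x V)"
        "s * f' - d * q = 0 \<or> degree_in x (s * f' - d * q) < degree_in x d"
      proof (cases "f' = 0")
        case True
        then show ?thesis using that[of 1 0] by simp
      next
        case False
        then show ?thesis using less.hyps[of f'] f' f'_in that by blast
      qed
      have "s * f' - d * q = (s * e) * f - d * (q + s * c * X x ^ n)"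
        by (simp add: f'_def algebra_simps)
      moreover have "q + s * c * X x ^ n \<in> polys_in (insert x V)"
        using sq ec sub by (intro polys_in_add polys_in_mult polys_in_power polys_in_X) auto
      ultimately show ?thesis
        using sq ec by (intro exI[of _ "s * e"] exI[of _ "q + s * c * X x ^ n"]) auto
    qed
  qed
  then show ?thesis using that by blast
qed

text \<open>
  Together with the additivity of the total degree this says that polynomial rings over fields are
  factorial.  The induction adds a variable \<open>x\<close> in the manner of Nagata.  If no prime of the
  coefficient ring divides \<open>p\<close>, let \<open>c\<close> be of least positive degree in \<open>x\<close> among the divisors of the
  multiples \<open>s * p\<close> of \<open>p\<close> by nonzero elements \<open>s\<close> of the coefficient ring: over its fraction field,
  \<open>c\<close> is an irreducible factor of \<open>p\<close>.  If in addition the total degree of \<open>c\<close> is least, then no prime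
  of the coefficient ring divides \<open>c\<close>.  When testing divisibility by such a \<open>c\<close>, nonzero elements of
  the coefficient ring may be cancelled (\<open>cancel\<close> in the proof),
  and its primality follows from Euclid's argument for polynomials over a field.
\<close>

theorem exists_prime_in_divisor:
  assumes "finite V" "p \<in> polys_in V" "p \<noteq> 0" "\<not> p dvd 1"
  shows "\<exists>\<pi>. prime_in V \<pi> \<and> \<pi> dvd p"
  using assms
proof (induction V arbitrary: p rule: finite_induct)
  case empty
  then have "homogeneous 0 p" by (auto simp: homogeneous_def polys_in_def)
  then show ?case using empty is_unit_if_homogeneous_0 by blast
next
  case (insert x V p)
  let ?R = "polys_in (insert x V) :: 'a mvpoly set"
  note x = \<open>x \<notin> V\<close>
  have sub: "q \<in> ?R" if "q \<in> polys_in V" for q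
    using that polys_in_mono[of V "insert x V"] by blast
  \<comment> \<open>primitivity with respect to the coefficient ring\<close>
  define prim where "prim c \<longleftrightarrow> (\<forall>\<rho>. prime_in V \<rho> \<longrightarrow> \<not> \<rho> dvd c)" for c :: "'a mvpoly"
  have cancel: "c dvd a"
    if c: "c \<in> ?R" "prim c" and a: "a \<in> ?R" and s: "s \<in> polys_in V" "s \<noteq> 0" "c dvd s * a" for c a s
    using s
  proof (induction "total_degree s" arbitrary: s rule: less_induct)
    case less
    show ?case
    proof (cases "s dvd 1")
      case True
      then have "s * a dvd 1 * a" by (intro mult_dvd_mono) auto
      then have "s * a dvd a" by simp
      then show ?thesis using less.prems(3) dvd_trans by blast
    next
      case False
      then obtain \<rho> s' where \<rho>: "prime_in V \<rho>" and s': "s = \<rho> * s'"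
        using insert.IH[OF less.prems(1,2)] unfolding dvd_def by blast
      have s'_in: "s' \<in> polys_in V" "s' \<noteq> 0"
        using less.prems(1,2) polys_in_cofactor unfolding s' by auto
      obtain b where b: "s * a = c * b" using less.prems(3) unfolding dvd_def by blast
      have "c dvd s' * a"
      proof (cases "a = 0")
        case False
        then have "b \<in> ?R"
          using polys_in_cofactor[of c b] b a sub less.prems by (metis mult_eq_0_iff polys_in_mult)
        moreover have "\<rho> dvd c * b" using b s' by (metis dvd_mult2 dvd_triv_left)
        ultimately have "\<rho> dvd b"
          using prime_in_dvd_multD[OF prime_in_insert[OF \<rho> x]] c \<rho> by (auto simp: prim_def)
        then obtain b' where "b = \<rho> * b'" unfolding dvd_def by blast
        then have "\<rho> * (s' * a) = \<rho> * (c * b')" using b s' by (simp add: mult_ac)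
        then show ?thesis using prime_in_not_0[OF \<rho>] by simp
      qed simp
      moreover have "total_degree s' < total_degree s"
        using total_degree_mult[of \<rho> s'] total_degree_prime_in[OF \<rho>] prime_in_not_0[OF \<rho>] s'_in
        by (simp add: s')
      ultimately show ?thesis using less.hyps s'_in by blast
    qed
  qed
  show ?case
  proof (cases "prim p")
    case False
    then show ?thesis using prime_in_insert[OF _ x] by (auto simp: prim_def)
  next
    case True
    \<comment> \<open>the divisors of \<open>p\<close> over the fraction field of the coefficient ring\<close>
    define S where "S = {c \<in> ?R. degree_in x c > 0 \<and> (\<exists>s \<in> polys_in V. s \<noteq> 0 \<and> c dvd s * p)}"
    have "p \<notin> polys_in V" using insert.IH[of p] insert.prems True by (auto simp: prim_def)
    then have "p \<in> S"
      using degree_in_eq_0[OF insert.prems(1)]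
      by (auto simp: S_def insert.prems intro!: bexI[of _ 1])
    then obtain c0 where c0: "c0 \<in> S" "\<And>d. d \<in> S \<Longrightarrow> degree_in x c0 \<le> degree_in x d"
      using ex_has_least_nat[of "\<lambda>c. c \<in> S" p "degree_in x"] by blast
    then obtain c where c: "c \<in> S" "degree_in x c = degree_in x c0"
      and td: "\<And>d. d \<in> S \<Longrightarrow> degree_in x d = degree_in x c0 \<Longrightarrow> total_degree c \<le> total_degree d"
      using ex_has_least_nat[of "\<lambda>c. c \<in> S \<and> degree_in x c = degree_in x c0" c0 total_degree] by blast
    have xd: "degree_in x c \<le> degree_in x d" if "d \<in> S" for d using that c0 c(2) by simp
    have cR: "c \<in> ?R" and c_deg: "degree_in x c > 0" using c(1) by (auto simp: S_def)
    then have cnz: "c \<noteq> 0" by (auto simp: degree_in_def)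
    obtain s where s: "s \<in> polys_in V" "s \<noteq> 0" "c dvd s * p" using c(1) by (auto simp: S_def)
    have "prim c"
      unfolding prim_def
    proof (intro allI impI notI)
      fix \<rho> assume \<rho>: "prime_in V \<rho>" and "\<rho> dvd c"
      then obtain c' where c': "c = \<rho> * c'" unfolding dvd_def by blast
      have nz: "\<rho> \<noteq> 0" "c' \<noteq> 0" using cnz c' by auto
      have dx: "degree_in x c' = degree_in x c"
        using degree_in_mult[OF nz] degree_in_free[OF prime_in_carrier[OF \<rho>] x] c' by simp
      have "c' \<in> S"
        unfolding S_def
      proof (intro CollectI conjI bexI[of _ s])
        show "c' \<in> ?R" using polys_in_cofactor[of \<rho> c'] cR cnz c' by simp
        show "c' dvd s * p" using s(3) c' by (metis dvd_mult_right)
      qed (use s dx c_deg in auto)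
      moreover have "total_degree c' < total_degree c"
        using total_degree_mult[OF nz] total_degree_prime_in[OF \<rho>] c' by simp
      ultimately show False using td[of c'] dx c(2) by simp
    qed
    have "c dvd p" using cancel[OF cR \<open>prim c\<close> insert.prems(1) s] .
    moreover have "prime_in (insert x V) c"
      unfolding prime_in_def
    proof (intro conjI ballI impI)
      show "\<not> c dvd 1"
      proof
        assume "c dvd 1"
        then obtain b where b: "1 = c * b" unfolding dvd_def by blast
        then have "b \<noteq> 0" by auto
        then have "degree_in x (1 :: 'a mvpoly) = degree_in x c + degree_in x b"
          using degree_in_mult[OF cnz, of b x] b by simp
        then show False using c_deg degree_in_free[of "1 :: 'a mvpoly" "{}" x] by simp
      qed
      fix a b assume ab: "a \<in> ?R" "b \<in> ?R" "c dvd a * b"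
      show "c dvd a \<or> c dvd b"
      proof (rule disjCI)
        assume "\<not> c dvd b"
        \<comment> \<open>a nonzero \<open>d\<close> of least degree in the ideal of \<open>c\<close> and \<open>a\<close> divides both of them, up to coefficients\<close>
        define J where "J = {d. d \<noteq> 0 \<and> (\<exists>u \<in> ?R. \<exists>v \<in> ?R. d = u * c + v * a)}"
        have "c = 1 * c + 0 * a" by simp
        then have "c \<in> J" using cnz polys_in_0 polys_in_1 unfolding J_def by blast
        then obtain d where d: "d \<in> J" "\<And>d'. d' \<in> J \<Longrightarrow> degree_in x d \<le> degree_in x d'"
          using ex_has_least_nat[of "\<lambda>c. c \<in> J" c "degree_in x"] by blast
        obtain u v where uv: "u \<in> ?R" "v \<in> ?R" "d = u * c + v * a" and dnz: "d \<noteq> 0"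
          using d(1) by (auto simp: J_def)
        have dR: "d \<in> ?R" using uv cR ab by simp
        have pd: "\<exists>s \<in> polys_in V. \<exists>q \<in> ?R. s \<noteq> 0 \<and> s * f = d * q"
          if f: "f = u' * c + v' * a" "u' \<in> ?R" "v' \<in> ?R" for f u' v'
        proof -
          have fR: "f \<in> ?R" using f cR ab by simp
          obtain s q where sq: "s \<in> polys_in V" "s \<noteq> 0" "q \<in> ?R"
            "s * f - d * q = 0 \<or> degree_in x (s * f - d * q) < degree_in x d"
            using pseudo_division[OF x dR dnz fR] by blast
          have "s * f - d * q = (s * u' - q * u) * c + (s * v' - q * v) * a"
            unfolding f uv(3) by (simp add: algebra_simps)
          moreover have "s * u' - q * u \<in> ?R" "s * v' - q * v \<in> ?R"
            using sq sub f uv by auto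
          ultimately have "s * f - d * q \<in> J" if "s * f - d * q \<noteq> 0"
            using that unfolding J_def by blast
          then have "s * f - d * q = 0" using sq(4) d(2) by force
          then show ?thesis using sq by auto
        qed
        obtain s1 q1 where 1: "s1 \<in> polys_in V" "s1 \<noteq> 0" "q1 \<in> ?R" "s1 * c = d * q1"
          using pd[of c 1 0] by auto
        obtain s2 q2 where 2: "s2 \<in> polys_in V" "s2 \<noteq> 0" "q2 \<in> ?R" "s2 * a = d * q2"
          using pd[of a 0 1] by auto
        \<comment> \<open>if \<open>d\<close> were a coefficient, then \<open>c\<close> and \<open>a\<close> would be coprime and \<open>c\<close> would divide \<open>b\<close>\<close>
        have "degree_in x d > 0"
        proof (rule ccontr)
          assume "\<not> degree_in x d > 0"
          then have "d \<in> polys_in V" using degree_in_eq_0[OF dR] by simp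
          moreover have "d * b = c * (u * b) + v * (a * b)" by (simp add: uv(3) algebra_simps)
          then have "c dvd d * b" using ab(3) by simp
          ultimately show False
            using cancel[OF cR \<open>prim c\<close> ab(2) _ dnz] \<open>\<not> c dvd b\<close> by blast
        qed
        have q1nz: "q1 \<noteq> 0" using 1 cnz by auto
        have "d \<in> S"
          unfolding S_def
        proof (intro CollectI conjI bexI[of _ "s1 * s"])
          have "d dvd s1 * c" using 1(4) by simp
          also have "\<dots> dvd s1 * (s * p)" using s(3) by simp
          finally show "d dvd s1 * s * p" by (simp add: mult.assoc)
        qed (use dR 1 s \<open>degree_in x d > 0\<close> in auto)
        \<comment> \<open>by minimality \<open>c\<close> and \<open>d\<close> agree up to coefficients, so that \<open>c\<close> divides \<open>a\<close> because \<open>d\<close> does\<close>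
        then have "degree_in x c \<le> degree_in x d" by (rule xd)
        moreover have "degree_in x c = degree_in x d + degree_in x q1"
          using degree_in_mult[OF dnz q1nz] degree_in_mult[OF 1(2) cnz] degree_in_free[OF 1(1) x] 1(4)
          by simp
        ultimately have "q1 \<in> polys_in V" using degree_in_eq_0[OF 1(3)] by simp
        have "s2 * q1 * a = (d * q1) * q2" using 2(4) by (simp add: mult_ac)
        also have "\<dots> = c * (s1 * q2)" by (simp add: mult_ac flip: 1(4))
        finally have "c dvd s2 * q1 * a" by simp
        then show "c dvd a"
          using cancel[OF cR \<open>prim c\<close> ab(1), of "s2 * q1"] 2 q1nz \<open>q1 \<in> polys_in V\<close> by simp
      qed
    qed (use cR cnz in auto)
    ultimately show ?thesis by blast
  qed
qed

text \<open>
  A vector \<open>s\<close> that is proportional to a vector \<open>r\<close> over the fraction field, with ratio \<open>w / u\<close>, is a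
  multiple of \<open>r\<close> in the ring when the entries of \<open>r\<close> have no common prime divisor: each prime divisor of
  the denominator \<open>u\<close> fails to divide some entry of \<open>r\<close>, so it divides \<open>w\<close> and can be cancelled.
\<close>

lemma proportional_to_primitive:
  assumes V: "finite V" and r: "\<And>i. i \<in> I \<Longrightarrow> r i \<in> polys_in V"
    and prim: "\<And>\<pi>. prime_in V \<pi> \<Longrightarrow> \<exists>i\<in>I. \<not> \<pi> dvd r i"
    and u: "u \<in> polys_in V" "u \<noteq> 0" and w: "w \<in> polys_in V"
    and eq: "\<And>i. i \<in> I \<Longrightarrow> u * s i = w * r i"
  shows "\<exists>b. \<forall>i\<in>I. s i = b * r i"
  using u w eq
proof (induction "total_degree u" arbitrary: u w rule: less_induct)
  case less
  show ?case
  proof (cases "u dvd 1")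
    case True
    then obtain t where t: "1 = u * t" unfolding dvd_def by blast
    have "s i = (t * w) * r i" if "i \<in> I" for i
    proof -
      have "s i = (u * t) * s i" by (simp flip: t)
      also have "\<dots> = t * (u * s i)" by (simp add: mult_ac)
      finally show ?thesis by (simp add: less.prems(4)[OF that] mult_ac)
    qed
    then show ?thesis by blast
  next
    case False
    then obtain \<pi> u' where \<pi>: "prime_in V \<pi>" and u': "u = \<pi> * u'"
      using exists_prime_in_divisor[OF V less.prems(1,2)] unfolding dvd_def by blast
    obtain i where i: "i \<in> I" "\<not> \<pi> dvd r i" using prim[OF \<pi>] by blast
    have "\<pi> dvd w * r i" using less.prems(4)[OF i(1)] u' by (metis dvd_mult2 dvd_triv_left)
    then obtain w' where w': "w = \<pi> * w'"
      using prime_in_dvd_multD[OF \<pi>] less.prems(3) r[OF i(1)] i(2) unfolding dvd_def by blast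
    have nz: "\<pi> \<noteq> 0" "u' \<noteq> 0" using less.prems(2) u' by auto
    show ?thesis
    proof (rule less.hyps[of u' w'])
      show "total_degree u' < total_degree u"
        using total_degree_mult[OF nz] total_degree_prime_in[OF \<pi>] u' by simp
      show "u' \<in> polys_in V" using polys_in_cofactor less.prems(1,2) u' by metis
      show "w' \<in> polys_in V"
        using polys_in_cofactor[of \<pi> w' V] less.prems(3) w' nz by (cases "w' = 0") auto
      show "u' * s j = w' * r j" if "j \<in> I" for j
      proof -
        have "\<pi> * (u' * s j) = \<pi> * (w' * r j)" using less.prems(4)[OF that] u' w' by (simp add: mult.assoc)
        then show ?thesis using nz by simp
      qed
    qed (use nz in auto)
  qed
qed

section \<open>Linear forms and reduction modulo a linear form\<close>

lemma diff_dvd_poly_diff: "x - y dvd poly P x - poly P (y :: 'a::comm_ring_1)"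
proof (induction P)
  case (pCons a P)
  have "poly (pCons a P) x - poly (pCons a P) y = x * (poly P x - poly P y) + (x - y) * poly P y"
    by (simp add: algebra_simps)
  then show ?case using pCons by simp
qed simp

lemma polys_in_poly: "(\<And>i. coeff P i \<in> polys_in V) \<Longrightarrow> t \<in> polys_in V \<Longrightarrow> poly P t \<in> polys_in V"
  by (auto simp: poly_altdef intro!: polys_in_sum)

text \<open>
  A form that is linear in \<open>X m\<close> with constant leading coefficient allows \<open>X m\<close> to be eliminated: modulo
  \<open>\<alpha>\<close> it equals \<open>- \<rho> / c\<close>.  Together with the uniqueness of the remainder below, this identifies the quotient
  by \<open>\<alpha>\<close> with the polynomial ring in the other variables.
\<close>

lemma linear_reduction:
  assumes \<alpha>: "\<alpha> = Const c * X m + \<rho>" and c: "c \<noteq> 0" and \<rho>: "\<rho> \<in> polys_in W"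
    and p: "p \<in> polys_in (insert m W)"
  obtains q r where "p = \<alpha> * q + r" "r \<in> polys_in W"
proof -
  define t where "t = - (Const (1 / c) * \<rho>)"
  define r where "r = poly (univariate m p) t"
  have "X m - t = \<alpha> * Const (1 / c)"
    using Const_mult_inverse[OF c] by (simp add: \<alpha> t_def algebra_simps)
  then have "\<alpha> dvd X m - t" by simp
  also have "X m - t dvd poly (univariate m p) (X m) - poly (univariate m p) t"
    by (rule diff_dvd_poly_diff)
  finally obtain q where "p - r = \<alpha> * q" by (auto simp: r_def dvd_def)
  then have "p = \<alpha> * q + r" by (simp add: algebra_simps)
  moreover have "r \<in> polys_in W"
    unfolding r_def using coeff_univariate_in[OF p] \<rho> by (intro polys_in_poly) (auto simp: t_def)
  ultimately show ?thesis using that by blast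
qed

text \<open>
  A nonzero polynomial without \<open>X m\<close> has no divisor that involves \<open>X m\<close>.
\<close>

lemma linear_dvd_free:
  assumes \<alpha>: "\<alpha> = Const c * X m + \<rho>" and c: "c \<noteq> 0" and \<rho>: "\<rho> \<in> polys_in W" and m: "m \<notin> W"
    and r: "r \<in> polys_in W" "\<alpha> dvd r"
  shows "r = 0"
proof (rule ccontr)
  assume "r \<noteq> 0"
  then have "\<alpha> \<in> polys_in W" using r unfolding dvd_def by (metis polys_in_divisor)
  then have "degree_in m \<alpha> = 0" using m by (rule degree_in_free)
  moreover have "univariate m \<alpha> = [:\<rho>, Const c:]"
    unfolding \<alpha> using univariate_free[OF \<rho> m]
    by (simp add: univariate_add univariate_mult univariate_Const univariate_X smult_monom monom_Suc monom_0)
  ultimately show False using c by (simp add: degree_in_def)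
qed

text \<open>
  The quotient by \<open>\<alpha>\<close> is a polynomial ring, hence a domain.
\<close>

lemma linear_in_variable_dvd_mult:
  assumes \<alpha>: "\<alpha> = Const c * X m + \<rho>" and c: "c \<noteq> 0" and \<rho>: "\<rho> \<in> polys_in W" and m: "m \<notin> W"
    and ab: "\<alpha> dvd a * b"
  shows "\<alpha> dvd a \<or> \<alpha> dvd b"
proof -
  let ?W = "- {m}"
  have \<rho>': "\<rho> \<in> polys_in ?W" using \<rho> m polys_in_mono[of W ?W] by auto
  have U: "p \<in> polys_in (insert m ?W)" for p :: "'a mvpoly" by (auto simp: polys_in_def)
  obtain q r where 1: "a = \<alpha> * q + r" "r \<in> polys_in ?W" using linear_reduction[OF \<alpha> c \<rho>' U] by blast
  obtain q' r' where 2: "b = \<alpha> * q' + r'" "r' \<in> polys_in ?W" using linear_reduction[OF \<alpha> c \<rho>' U] by blast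
  have "a * b = \<alpha> * (q * b + r * q') + r * r'" unfolding 1 2 by (simp add: algebra_simps)
  then have "\<alpha> dvd r * r'" using ab by (simp add: dvd_add_right_iff)
  then have "r * r' = 0"
    using linear_dvd_free[OF \<alpha> c \<rho>' _ polys_in_mult[OF 1(2) 2(2)]] by simp
  then show ?thesis using 1 2 by auto
qed

lemma mon_deg_eq_1_imp_single:
  assumes "mon_deg k = 1" "m \<in> Poly_Mapping.keys k"
  shows "k = Poly_Mapping.single m 1"
proof -
  have "mon_deg k = Poly_Mapping.lookup k m + (\<Sum>j\<in>Poly_Mapping.keys k - {m}. Poly_Mapping.lookup k j)"
    unfolding mon_deg_def using assms(2) by (subst sum.remove[of _ m]) auto
  moreover have "Poly_Mapping.lookup k m \<noteq> 0" using assms(2) by (simp add: in_keys_iff)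
  ultimately have l: "Poly_Mapping.lookup k m = 1"
    and "(\<Sum>j\<in>Poly_Mapping.keys k - {m}. Poly_Mapping.lookup k j) = 0" using assms(1) by linarith+
  then have "\<forall>j\<in>Poly_Mapping.keys k - {m}. Poly_Mapping.lookup k j = 0" by simp
  then have "Poly_Mapping.lookup k j = 0" if "j \<noteq> m" for j
    using that by (metis DiffI in_keys_iff singletonD)
  then show ?thesis
    using l by (intro poly_mapping_eqI) (auto simp: lookup_single when_def)
qed

text \<open>
  A nonzero linear form involves some variable \<open>X m\<close>, which makes the elimination above applicable to
  it.
\<close>

lemma linear_decomposition:
  assumes "p \<in> polys_in V" "homogeneous 1 p" "p \<noteq> 0"
  obtains m c \<rho> where "m \<in> V" "c \<noteq> 0" "\<rho> \<in> polys_in (V - {m})" "p = Const c * X m + \<rho>"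
proof -
  obtain k where k: "k \<in> Poly_Mapping.keys p"
    using assms(3) by (metis ex_in_conv keys_eq_empty)
  then have k1: "mon_deg k = 1" using assms(2) by (simp add: homogeneous_def)
  then obtain m where m: "m \<in> Poly_Mapping.keys k"
    by (metis ex_in_conv keys_eq_empty mon_deg_0 zero_neq_one)
  define c where "c = Poly_Mapping.lookup p k"
  define \<rho> where "\<rho> = p - Const c * X m"
  have CX: "Const c * X m = Poly_Mapping.single k c"
    using mon_deg_eq_1_imp_single[OF k1 m] by (simp add: Const_def X_def mult_single)
  have "\<rho> \<in> polys_in (V - {m})"
    unfolding polys_in_def
  proof (intro CollectI ballI)
    fix n assume n: "n \<in> Poly_Mapping.keys \<rho>"
    moreover have "Poly_Mapping.lookup \<rho> n = (if n = k then 0 else Poly_Mapping.lookup p n)"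
      unfolding \<rho>_def CX by (simp add: lookup_minus lookup_single when_def) (simp add: c_def)
    ultimately have "n \<noteq> k" "n \<in> Poly_Mapping.keys p"
      by (auto simp: in_keys_iff split: if_splits)
    moreover from this have "mon_deg n = 1" using assms(2) by (simp add: homogeneous_def)
    ultimately show "Poly_Mapping.keys n \<subseteq> V - {m}"
      using assms(1) mon_deg_eq_1_imp_single[of n m] mon_deg_eq_1_imp_single[OF k1 m] by (auto simp: polys_in_def)
  qed
  moreover have "m \<in> V" using k m assms(1) by (auto simp: polys_in_def)
  moreover have "c \<noteq> 0" using k by (simp add: c_def in_keys_iff)
  moreover have "p = Const c * X m + \<rho>" by (simp add: \<rho>_def)
  ultimately show ?thesis using that by blast
qed

lemma homogeneous_unique:
  assumes "homogeneous d p" "homogeneous e p" "p \<noteq> 0"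
  shows "d = e"
  using assms by (metis ex_in_conv homogeneous_def keys_eq_empty)

lemma homogeneous_X: "homogeneous 1 (X j)"
  by (simp add: homogeneous_def X_def mon_deg_def)

lemma homogeneous_Const: "homogeneous 0 (Const c)"
  by (simp add: homogeneous_def Const_def)

lemma linear_form_in: "linear_form l a \<in> polys_in {..<l}"
  unfolding linear_form_def by (intro polys_in_sum polys_in_mult polys_in_X) auto

lemma homogeneous_linear_form: "homogeneous 1 (linear_form l a)"
  unfolding linear_form_def
  using homogeneous_mult[OF homogeneous_Const homogeneous_X] by (intro homogeneous_sum) auto

lemma lookup_linear_form:
  assumes "j < l"
  shows "Poly_Mapping.lookup (linear_form l a) (Poly_Mapping.single j 1) = a $ j"
proof -
  have "Poly_Mapping.single i (1::nat) = Poly_Mapping.single j 1 \<longleftrightarrow> i = j" for i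
    by (metis keys_single singleton_inject zero_neq_one)
  then have "Poly_Mapping.lookup (linear_form l a) (Poly_Mapping.single j 1) = (\<Sum>i<l. if i = j then a $ j else 0)"
    unfolding linear_form_def lookup_sum
    by (intro sum.cong) (auto simp: Const_def X_def mult_single lookup_single when_def)
  then show ?thesis using assms by simp
qed

lemma linear_form_nonzero:
  assumes "a \<in> carrier_vec l" "a \<noteq> 0\<^sub>v l"
  shows "linear_form l a \<noteq> 0"
proof -
  obtain j where "j < l" "a $ j \<noteq> 0" using assms by (auto simp: vec_eq_iff)
  then show ?thesis using lookup_linear_form[of j l a] by auto
qed

lemma homogeneous_linear_dvd_mult:
  assumes "p \<in> polys_in V" "homogeneous 1 p" "p \<noteq> 0" "p dvd a * b"
  shows "p dvd a \<or> p dvd b"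
proof -
  obtain m c \<rho> where "c \<noteq> 0" "\<rho> \<in> polys_in (V - {m})" "p = Const c * X m + \<rho>"
    using linear_decomposition[OF assms(1-3)] by blast
  then show ?thesis using linear_in_variable_dvd_mult[of p c m \<rho> "V - {m}"] assms(4) by auto
qed

text \<open>
  The quotient of two linear forms is homogeneous of degree 0, hence constant.
\<close>

lemma dvd_imp_same_hyperplane:
  assumes "defines_hyperplane l p H" "defines_hyperplane l p' H'" "p dvd p'"
  shows "H = H'"
proof -
  obtain a where a: "a \<in> carrier_vec l" "a \<noteq> 0\<^sub>v l" "p = linear_form l a" "H = {v \<in> carrier_vec l. a \<bullet> v = 0}"
    using assms(1) unfolding defines_hyperplane_def by blast
  obtain a' where a': "a' \<in> carrier_vec l" "a' \<noteq> 0\<^sub>v l" "p' = linear_form l a'" "H' = {v \<in> carrier_vec l. a' \<bullet> v = 0}"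
    using assms(2) unfolding defines_hyperplane_def by blast
  obtain q where q: "p' = q * p" using assms(3) by (metis dvd_def mult.commute)
  have nz: "p' \<noteq> 0" using linear_form_nonzero[OF a'(1,2)] a'(3) by simp
  obtain e where e: "homogeneous e q"
    using homogeneous_divisor[of 1 q p] homogeneous_linear_form[of l a'] nz a'(3) q by metis
  then have "homogeneous (e + 1) p'"
    using homogeneous_mult[OF e homogeneous_linear_form[of l a]] a(3) q by simp
  then have "e = 0" using homogeneous_unique[OF _ _ nz] homogeneous_linear_form[of l a'] a'(3) by force
  then obtain c where c: "q = Const c" using e homogeneous_0_imp_Const by metis
  have "a' $ j = c * a $ j" if "j < l" for j
  proof -
    have "linear_form l a' = linear_form l (c \<cdot>\<^sub>v a)"
      using q a(1) by (simp add: c a(3) a'(3) linear_form_def sum_distrib_left mult.assoc)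
    then show ?thesis
      using lookup_linear_form[OF that, of a'] lookup_linear_form[OF that, of "c \<cdot>\<^sub>v a"] that a(1) by simp
  qed
  then have "a' = c \<cdot>\<^sub>v a" using a(1) a'(1) by (intro eq_vecI) auto
  moreover have "c \<noteq> 0" using nz q c by auto
  ultimately show ?thesis using a a' by auto
qed

lemma homogeneous_pos_not_unit:
  assumes "homogeneous d p" "d > 0"
  shows "\<not> p dvd 1"
proof
  assume "p dvd 1"
  then obtain b where b: "b * p = 1" by (metis dvd_def mult.commute)
  then obtain e where "homogeneous e b"
    using homogeneous_divisor[of 0 b p] homogeneous_one by auto
  then have "homogeneous (e + d) (1 :: 'a mvpoly)"
    using homogeneous_mult[OF _ assms(1)] b by metis
  then show False using homogeneous_unique[OF _ homogeneous_one] assms(2) by fastforce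
qed

lemma defines_hyperplaneD:
  assumes "defines_hyperplane l p H"
  shows "p \<in> polys_in {..<l}" "homogeneous 1 p" "p \<noteq> 0"
proof -
  obtain a where "a \<in> carrier_vec l" "a \<noteq> 0\<^sub>v l" "p = linear_form l a"
    using assms unfolding defines_hyperplane_def by blast
  then show "p \<in> polys_in {..<l}" "homogeneous 1 p" "p \<noteq> 0"
    using linear_form_in homogeneous_linear_form linear_form_nonzero by metis+
qed

text \<open>
  Defining forms of distinct hyperplanes are pairwise non-associated primes, so common multiples of them
  are multiples of their product.
\<close>

lemma prod_hyperplane_forms_dvd:
  assumes "finite F" "\<And>H. H \<in> F \<Longrightarrow> defines_hyperplane l (\<alpha> H) H" "\<And>H. H \<in> F \<Longrightarrow> \<alpha> H dvd D"
  shows "(\<Prod>H\<in>F. \<alpha> H) dvd D"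
  using assms
proof (induction F rule: finite_induct)
  case (insert H F)
  obtain k where k: "D = (\<Prod>H\<in>F. \<alpha> H) * k" using insert unfolding dvd_def by blast
  have dh: "defines_hyperplane l (\<alpha> K) K" if "K \<in> insert H F" for K using insert.prems(1) that .
  have prime: "\<alpha> H dvd a \<or> \<alpha> H dvd b" if "\<alpha> H dvd a * b" for a b
    using homogeneous_linear_dvd_mult[OF defines_hyperplaneD[OF dh] that] by simp
  have "\<not> \<alpha> H dvd (\<Prod>K\<in>G. \<alpha> K)" if "G \<subseteq> F" for G
    using finite_subset[OF that insert.hyps(1)] that
  proof (induction G rule: finite_induct)
    case empty
    show ?case using homogeneous_pos_not_unit[OF defines_hyperplaneD(2)[OF dh[of H]]] by simp
  next
    case (insert H' G)
    have "H' \<noteq> H" "H' \<in> F" using insert \<open>H \<notin> F\<close> by auto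
    then have "\<not> \<alpha> H dvd \<alpha> H'"
      using dvd_imp_same_hyperplane[OF dh[of H] dh[of H']] by auto
    then show ?case using insert prime[of "\<alpha> H'" "\<Prod>K\<in>G. \<alpha> K"] by auto
  qed
  then have "\<not> \<alpha> H dvd (\<Prod>K\<in>F. \<alpha> K)" by blast
  moreover have "\<alpha> H dvd (\<Prod>K\<in>F. \<alpha> K) * k" using insert.prems(2)[of H] k by simp
  ultimately have "\<alpha> H dvd k" using prime by blast
  then show ?case using k insert.hyps by (simp add: mult.commute mult_dvd_mono)
qed simp

section \<open>Derivations\<close>

lemma Der_closed: "\<theta> \<in> Der l \<Longrightarrow> p \<in> polys_in {..<l} \<Longrightarrow> \<theta> p \<in> polys_in {..<l}"
  by (auto simp: Der_def carrier_poly_ring)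

lemma Der_add: "\<theta> \<in> Der l \<Longrightarrow> p \<in> polys_in {..<l} \<Longrightarrow> q \<in> polys_in {..<l} \<Longrightarrow> \<theta> (p + q) = \<theta> p + \<theta> q"
  by (auto simp: Der_def carrier_poly_ring)

lemma Der_scale: "\<theta> \<in> Der l \<Longrightarrow> p \<in> polys_in {..<l} \<Longrightarrow> \<theta> (Const c * p) = Const c * \<theta> p"
  by (auto simp: Der_def carrier_poly_ring)

lemma Der_mult: "\<theta> \<in> Der l \<Longrightarrow> p \<in> polys_in {..<l} \<Longrightarrow> q \<in> polys_in {..<l} \<Longrightarrow> \<theta> (p * q) = \<theta> p * q + p * \<theta> q"
  by (auto simp: Der_def carrier_poly_ring)

lemma Der_Const: assumes "\<theta> \<in> Der l" shows "\<theta> (Const c) = 0"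
proof -
  have "\<theta> (1 * 1) = \<theta> 1 * 1 + 1 * \<theta> 1" by (rule Der_mult[OF assms]) auto
  then have "\<theta> 1 = \<theta> 1 + \<theta> 1" by (simp only: mult_1_right mult_1_left)
  then have "\<theta> 1 = 0" by (metis add_cancel_right_right)
  then show ?thesis using Der_scale[OF assms, of 1 c] by simp
qed

lemma Der_sum:
  assumes "\<theta> \<in> Der l" "finite J" "\<And>j. j \<in> J \<Longrightarrow> f j \<in> polys_in {..<l}"
  shows "\<theta> (\<Sum>j\<in>J. f j) = (\<Sum>j\<in>J. \<theta> (f j))"
  using assms(2,3)
proof (induction J rule: finite_induct)
  case empty
  then show ?case using Der_Const[OF assms(1), of 0] by simp
next
  case (insert x F)
  then show ?case by (simp add: Der_add[OF assms(1)] polys_in_sum)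
qed

lemma Der_linear_form:
  assumes "\<theta> \<in> Der l"
  shows "\<theta> (linear_form l a) = (\<Sum>j<l. Const (a $ j) * \<theta> (X j))"
  unfolding linear_form_def
  by (subst Der_sum[OF assms]) (auto simp: polys_in_X Der_scale[OF assms])

lemma Der_eqI:
  assumes \<theta>: "\<theta> \<in> Der l" and \<eta>: "\<eta> \<in> Der l" and eq: "\<And>j. j < l \<Longrightarrow> \<theta> (X j) = \<eta> (X j)"
  shows "\<theta> = \<eta>"
proof (rule ext)
  fix p
  show "\<theta> p = \<eta> p"
  proof (cases "p \<in> polys_in {..<l}")
    case True
    then show ?thesis
      by (induction rule: polys_in_induct)
        (use eq in \<open>simp_all add: Der_Const[OF \<theta>] Der_Const[OF \<eta>] Der_add[OF \<theta>] Der_add[OF \<eta>]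
          Der_mult[OF \<theta>] Der_mult[OF \<eta>]\<close>)
  next
    case False
    then show ?thesis using \<theta> \<eta> by (auto simp: Der_def carrier_poly_ring PiE_iff extensional_def)
  qed
qed

lemma log_der_Der: "\<theta> \<in> log_der l A \<Longrightarrow> \<theta> \<in> Der l"
  by (simp add: log_der_def)

lemma log_der_X_in: "\<theta> \<in> log_der l A \<Longrightarrow> j < l \<Longrightarrow> \<theta> (X j) \<in> polys_in {..<l}"
  by (rule Der_closed[OF log_der_Der polys_in_X]) auto

lemma log_der_dvd:
  assumes "\<theta> \<in> log_der l A" "H \<in> A" "defines_hyperplane l p H"
  shows "p dvd \<theta> p"
proof -
  have "\<theta> p \<in> PIdl\<^bsub>poly_ring l\<^esub> p" using assms by (auto simp: log_der_def)
  then show ?thesis by (auto simp: cgenideal_def poly_ring_def)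
qed

section \<open>Determinants of logarithmic derivations\<close>

lemma det_column_dvd:
  fixes B :: "'a::comm_ring_1 mat"
  assumes "B \<in> carrier_mat n n" "k < n" "\<And>i. i < n \<Longrightarrow> p dvd B $$ (i, k)"
  shows "p dvd det B"
  unfolding laplace_expansion_column[OF assms(1,2)] using assms(3) by (intro dvd_sum) auto

lemma det_in:
  assumes "B \<in> carrier_mat n n" "\<And>i j. i < n \<Longrightarrow> j < n \<Longrightarrow> B $$ (i, j) \<in> polys_in V"
  shows "det B \<in> polys_in V"
  unfolding det_def'[OF assms(1)]
proof (intro polys_in_sum polys_in_mult polys_in_prod)
  fix \<sigma> i assume "\<sigma> \<in> {p. p permutes {0..<n}}" "i \<in> {0..<n}"
  then show "B $$ (i, \<sigma> i) \<in> polys_in V" using assms(2) permutes_in_image[of \<sigma> "{0..<n}" i] by auto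
qed (simp add: sign_def)

lemma det_homogeneous:
  fixes B :: "'k::field mvpoly mat"
  assumes "B \<in> carrier_mat n n" "\<And>i j. i < n \<Longrightarrow> j < n \<Longrightarrow> homogeneous (d i) (B $$ (i, j))"
  shows "homogeneous (\<Sum>i = 0..<n. d i) (det B)"
  unfolding det_def'[OF assms(1)]
proof (intro homogeneous_sum)
  fix \<sigma> assume \<sigma>: "\<sigma> \<in> {p. p permutes {0..<n}}"
  have "homogeneous (\<Sum>i = 0..<n. d i) (\<Prod>i = 0..<n. B $$ (i, \<sigma> i))"
    using assms(2) \<sigma> permutes_in_image[of \<sigma> "{0..<n}"] by (intro homogeneous_prod) auto
  then show "homogeneous (\<Sum>i = 0..<n. d i) (signof \<sigma> * (\<Prod>i = 0..<n. B $$ (i, \<sigma> i)))"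
    by (simp add: sign_def)
qed

lemma rows_independent:
  fixes B :: "'a::idom mat"
  assumes B: "B \<in> carrier_mat n n" "det B \<noteq> 0" and r: "r < n"
    and e: "\<And>c. c < n \<Longrightarrow> (\<Sum>k<n. e k * B $$ (k, c)) = 0"
  shows "e r = 0"
proof -
  note adj = adj_mat[OF B(1)]
  have unit: "(\<Sum>c<n. B $$ (k, c) * adj_mat B $$ (c, r)) = (if k = r then det B else 0)" if "k < n" for k
  proof -
    have "(\<Sum>c<n. B $$ (k, c) * adj_mat B $$ (c, r)) = (B * adj_mat B) $$ (k, r)"
      using that r B adj(1) by (simp add: scalar_prod_def atLeast0LessThan)
    also have "\<dots> = (if k = r then det B else 0)"
      unfolding adj(2) using that r by simp
    finally show ?thesis .
  qed
  have "e r * det B = (\<Sum>k<n. e k * (\<Sum>c<n. B $$ (k, c) * adj_mat B $$ (c, r)))"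
    using r by (simp add: unit if_distrib cong: if_cong)
  also have "\<dots> = (\<Sum>c<n. (\<Sum>k<n. e k * B $$ (k, c)) * adj_mat B $$ (c, r))"
    unfolding sum_distrib_left sum_distrib_right by (subst sum.swap) (simp add: mult.assoc)
  also have "\<dots> = 0" by (simp add: e)
  finally show ?thesis using B(2) by simp
qed

text \<open>
  Cramer's rule without division: \<open>det B\<close> times the vector \<open>v\<close> is a combination of the rows of \<open>B\<close>.  The
  coefficients are the determinants that arise by replacing one row of \<open>B\<close> by \<open>v\<close>.
\<close>

lemma cramer_row:
  fixes B :: "'a::comm_ring_1 mat"
  assumes B: "B \<in> carrier_mat n n" and c: "c < n"
  shows "(\<Sum>r<n. det (mat n n (\<lambda>(i, j). if i = r then v j else B $$ (i, j))) * B $$ (r, c)) = det B * v c"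
proof -
  note adj = adj_mat[OF B]
  have unit: "(\<Sum>r<n. adj_mat B $$ (k, r) * B $$ (r, c)) = (if k = c then det B else 0)" if "k < n" for k
  proof -
    have "(\<Sum>r<n. adj_mat B $$ (k, r) * B $$ (r, c)) = (adj_mat B * B) $$ (k, c)"
      using that c B adj(1) by (simp add: scalar_prod_def atLeast0LessThan)
    also have "\<dots> = (if k = c then det B else 0)"
      unfolding adj(3) using that c by simp
    finally show ?thesis .
  qed
  have "det (mat n n (\<lambda>(i, j). if i = r then v j else B $$ (i, j))) = (\<Sum>k<n. v k * adj_mat B $$ (k, r))"
    if r: "r < n" for r
  proof -
    let ?C = "mat n n (\<lambda>(i, j). if i = r then v j else B $$ (i, j))"
    have "mat_delete ?C r k = mat_delete B r k" if "k < n" for k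
      using B r that by (intro eq_matI) (auto simp: mat_delete_def)
    then have "cofactor ?C r k = adj_mat B $$ (k, r)" if "k < n" for k
      using that r B by (simp add: cofactor_def adj_mat_def)
    then show ?thesis
      using r by (subst laplace_expansion_row[of ?C n r]) auto
  qed
  then have "(\<Sum>r<n. det (mat n n (\<lambda>(i, j). if i = r then v j else B $$ (i, j))) * B $$ (r, c))
      = (\<Sum>r<n. \<Sum>k<n. v k * (adj_mat B $$ (k, r) * B $$ (r, c)))"
    by (simp add: sum_distrib_right mult.assoc)
  also have "\<dots> = (\<Sum>k<n. v k * (\<Sum>r<n. adj_mat B $$ (k, r) * B $$ (r, c)))"
    unfolding sum_distrib_left by (rule sum.swap)
  also have "\<dots> = (\<Sum>k<n. if k = c then det B * v c else 0)"
    using unit by (intro sum.cong) (auto simp: mult.commute[of "det B"])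
  also have "\<dots> = det B * v c" using c by simp
  finally show ?thesis .
qed

definition der_matrix :: "nat \<Rightarrow> (nat \<Rightarrow> 'k::field mvpoly \<Rightarrow> 'k mvpoly) \<Rightarrow> 'k mvpoly mat" where
  "der_matrix l \<eta> = mat l l (\<lambda>(r, c). \<eta> r (X c))"

lemma der_matrix_carrier [simp]: "der_matrix l \<eta> \<in> carrier_mat l l"
  by (simp add: der_matrix_def)

lemma der_matrix_index [simp]: "r < l \<Longrightarrow> c < l \<Longrightarrow> der_matrix l \<eta> $$ (r, c) = \<eta> r (X c)"
  by (simp add: der_matrix_def)

text \<open>
  The easy half of Saito's criterion.  If \<open>\<alpha> H = \<Sum>j. a j * X j\<close> and \<open>a m \<noteq> 0\<close>, then up to the unit
  \<open>a m\<close> the determinant does not change when column \<open>m\<close> is replaced by the combination of the columns with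
  coefficients \<open>a j\<close>.  The entries of the new column are the values \<open>\<eta> r (\<alpha> H)\<close>, which \<open>\<alpha> H\<close> divides.
\<close>

lemma prod_hyperplanes_dvd_det:
  assumes "finite A" "\<And>H. H \<in> A \<Longrightarrow> defines_hyperplane l (\<alpha> H) H"
    and \<eta>: "\<And>r. r < l \<Longrightarrow> \<eta> r \<in> log_der l A"
  shows "(\<Prod>H\<in>A. \<alpha> H) dvd det (der_matrix l \<eta>)"
proof (rule prod_hyperplane_forms_dvd[OF assms(1,2)])
  fix H assume H: "H \<in> A"
  let ?B = "der_matrix l \<eta>"
  obtain a where a: "a \<in> carrier_vec l" "a \<noteq> 0\<^sub>v l" "\<alpha> H = linear_form l a"
    using assms(2)[OF H] unfolding defines_hyperplane_def by blast
  obtain m where m: "m < l" "a $ m \<noteq> 0" using a(1,2) by (auto simp: vec_eq_iff)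
  define x where "x = vec l (\<lambda>j. Const (a $ j))"
  have x: "x \<in> carrier_vec l" by (simp add: x_def)
  have Bx: "(?B *\<^sub>v x) $ r = \<eta> r (\<alpha> H)" if "r < l" for r
    using that Der_linear_form[OF log_der_Der[OF \<eta>[OF that]], of a]
    by (simp add: a(3) x_def scalar_prod_def atLeast0LessThan mult.commute der_matrix_def)
  have "\<alpha> H dvd det (replace_col ?B (?B *\<^sub>v x) m)"
  proof (rule det_column_dvd[OF _ m(1)])
    show "replace_col ?B (?B *\<^sub>v x) m \<in> carrier_mat l l"
      by (simp add: replace_col_def der_matrix_def)
    fix i assume i: "i < l"
    then have "replace_col ?B (?B *\<^sub>v x) m $$ (i, m) = \<eta> i (\<alpha> H)"
      using m Bx by (simp add: replace_col_def der_matrix_def)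
    then show "\<alpha> H dvd replace_col ?B (?B *\<^sub>v x) m $$ (i, m)"
      using log_der_dvd[OF \<eta>[OF i] H assms(2)[OF H]] by simp
  qed
  then have "\<alpha> H dvd Const (a $ m) * det ?B"
    using cramer_lemma_mat[OF der_matrix_carrier x m(1)] m by (simp add: x_def)
  then have "\<alpha> H dvd Const (1 / a $ m) * (Const (a $ m) * det ?B)" by (rule dvd_mult)
  then show "\<alpha> H dvd det ?B"
    using Const_mult_inverse[OF m(2)] by (simp flip: mult.assoc)
qed

text \<open>
  In Cramer's rule for rows of logarithmic derivations all determinants are divisible by the defining
  polynomial \<open>Q\<close>, so the rule can be divided by \<open>Q\<close>.
\<close>

lemma cramer_log_der:
  assumes A: "finite A" "\<And>H. H \<in> A \<Longrightarrow> defines_hyperplane l (\<alpha> H) H"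
    and \<eta>: "\<And>r. r < l \<Longrightarrow> \<eta> r \<in> log_der l A" and \<theta>: "\<theta> \<in> log_der l A"
    and u: "det (der_matrix l \<eta>) = u * (\<Prod>H\<in>A. \<alpha> H)"
  obtains w where "\<And>r. r < l \<Longrightarrow> w r \<in> polys_in {..<l}"
    "\<And>c. c < l \<Longrightarrow> u * \<theta> (X c) = (\<Sum>r<l. w r * \<eta> r (X c))"
proof -
  define Q where "Q = (\<Prod>H\<in>A. \<alpha> H)"
  have Q: "Q \<noteq> 0" using A defines_hyperplaneD(3) by (auto simp: Q_def)
  have ex: "\<exists>w. w \<in> polys_in {..<l} \<and> det (der_matrix l (\<eta>(r := \<theta>))) = w * Q" if "r < l" for r
  proof -
    let ?D = "det (der_matrix l (\<eta>(r := \<theta>)))"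
    have "Q dvd ?D"
      unfolding Q_def using \<eta> \<theta> by (intro prod_hyperplanes_dvd_det A) auto
    then obtain w where w: "?D = w * Q" by (metis dvd_def mult.commute)
    have "?D \<in> polys_in {..<l}"
      by (rule det_in[OF der_matrix_carrier]) (simp add: log_der_X_in[OF \<eta>] log_der_X_in[OF \<theta>])
    then have "w \<in> polys_in {..<l}"
      using w Q polys_in_divisor[of w Q] by (cases "w = 0") auto
    with w show ?thesis by blast
  qed
  then obtain w where w: "\<And>r. r < l \<Longrightarrow> w r \<in> polys_in {..<l}"
    "\<And>r. r < l \<Longrightarrow> det (der_matrix l (\<eta>(r := \<theta>))) = w r * Q" by metis
  have "u * \<theta> (X c) = (\<Sum>r<l. w r * \<eta> r (X c))" if c: "c < l" for c
  proof -
    have "mat l l (\<lambda>(i, j). if i = r then \<theta> (X j) else der_matrix l \<eta> $$ (i, j)) = der_matrix l (\<eta>(r := \<theta>))"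
      for r by (rule eq_matI) (auto simp: der_matrix_def)
    then have "(\<Sum>r<l. w r * Q * \<eta> r (X c)) = u * Q * \<theta> (X c)"
      using cramer_row[OF der_matrix_carrier c, of "\<lambda>j. \<theta> (X j)" \<eta>] c u by (simp add: w(2) Q_def)
    then have "Q * (\<Sum>r<l. w r * \<eta> r (X c)) = Q * (u * \<theta> (X c))"
      by (simp add: sum_distrib_left mult_ac)
    then show ?thesis using Q by simp
  qed
  then show ?thesis using that[of w] w(1) by blast
qed

text \<open>
  The rows of the minor that omits \<open>\<theta> i\<close> correspond to the derivations \<open>\<theta> j\<close> with \<open>j \<noteq> i\<close>; the shifts by 1
  reconcile matrix indices with the numbering of the derivations.
\<close>

lemma insert_index_bij:
  assumes "i \<in> {1..l+1}"
  shows "bij_betw (\<lambda>r. insert_index (i - 1) r + 1) {..<l} ({1..l+1} - {i})"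
proof -
  have "bij_betw (insert_index (i - 1)) {..<l} ({..<l+1} - {i - 1})"
  proof -
    have "i - 1 < Suc l" using assms by auto
    then show ?thesis
      unfolding bij_betw_def using insert_index_image[of "i - 1" l] insert_index_inj_on
      by (simp add: atLeast0LessThan)
  qed
  moreover have "bij_betw (\<lambda>r. r + 1) ({..<l+1} - {i - 1}) ({1..l+1} - {i})"
    using assms by (intro bij_betw_byWitness[of _ "\<lambda>r. r - 1"]) auto
  ultimately show ?thesis
    using bij_betw_trans[of "insert_index (i - 1)" _ _ "\<lambda>r. r + 1"] unfolding comp_def by blast
qed

lemma coeff_minor_eq:
  assumes "i \<in> {1..l+1}"
  shows "coeff_minor l \<theta> i = der_matrix l (\<lambda>r. \<theta> (insert_index (i - 1) r + 1))"
proof -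
  have "insert_index (i - 1) r < l + 1" if "r < l" for r
    using that by (simp add: insert_index_def)
  then show ?thesis
    by (intro eq_matI) (auto simp: coeff_minor_def coeff_matrix_def der_matrix_def)
qed

text \<open>
  Laplace expansion of a determinant with a repeated column: column \<open>c\<close> of the coefficient matrix is
  prefixed to it.
\<close>

lemma signed_minors_relation:
  assumes "c < l"
  shows "(\<Sum>i\<in>{1..l+1}. (-1) ^ i * det (coeff_minor l \<theta> i) * \<theta> i (X c)) = 0"
proof -
  define A where "A = mat (l + 1) (l + 1) (\<lambda>(r, k). if k = 0 then \<theta> (r + 1) (X c) else \<theta> (r + 1) (X (k - 1)))"
  have A: "A \<in> carrier_mat (l + 1) (l + 1)" by (simp add: A_def)
  have "det A = 0"
    using assms by (intro det_identical_columns[OF A, of 0 "c + 1"]) (auto simp: A_def)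
  moreover have "mat_delete A r 0 = coeff_minor l \<theta> (r + 1)" if "r < l + 1" for r
    using that by (intro eq_matI) (auto simp: mat_delete_def A_def coeff_minor_def coeff_matrix_def insert_index_def)
  then have "det A = (\<Sum>r<l+1. \<theta> (r + 1) (X c) * ((-1) ^ r * det (coeff_minor l \<theta> (r + 1))))"
    by (subst laplace_expansion_column[OF A, of 0])
      (auto simp: A_def cofactor_def intro!: sum.cong)
  moreover have "(\<Sum>i\<in>{1..l+1}. (-1) ^ i * det (coeff_minor l \<theta> i) * \<theta> i (X c))
     = (\<Sum>r<l+1. (-1) ^ (r + 1) * det (coeff_minor l \<theta> (r + 1)) * \<theta> (r + 1) (X c))"
    by (rule sum.reindex_bij_witness[of _ "\<lambda>r. r + 1" "\<lambda>i. i - 1"]) auto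
  ultimately show ?thesis by (simp add: sum_negf mult_ac)
qed

section \<open>Vectors proportional modulo a linear form\<close>

text \<open>
  For \<open>e \<noteq> d\<close> the component of degree \<open>e\<close> of the remainder is divisible by \<open>\<alpha>\<close>, hence 0 by uniqueness of
  remainders.
\<close>

lemma linear_reduction_homogeneous:
  assumes \<alpha>: "\<alpha> = Const c * X m + \<rho>" and c: "c \<noteq> 0" and \<rho>: "\<rho> \<in> polys_in W" and m: "m \<notin> W"
    and hom: "homogeneous 1 \<alpha>"
    and p: "homogeneous d (\<alpha> * q + r)" and r: "r \<in> polys_in W"
  shows "homogeneous d r"
  unfolding homogeneous_def
proof (rule ballI, rule ccontr)
  fix k assume k: "k \<in> Poly_Mapping.keys r" "mon_deg k \<noteq> d"
  define e where "e = mon_deg k"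
  have "monom (\<alpha> * q + r) d = monom \<alpha> 1 * grading q + grading r"
    using p hom by (simp add: homogeneous_iff_grading grading_add grading_mult)
  from arg_cong[OF this, of "\<lambda>P. coeff P e"]
  have "coeff (grading r) e = - (if 1 \<le> e then \<alpha> * coeff (grading q) (e - 1) else 0)"
    using k(2) by (simp add: e_def coeff_monom_mult add_eq_0_iff2 split: if_splits)
  then have "\<alpha> dvd coeff (grading r) e" by simp
  then have "coeff (grading r) e = 0"
    using linear_dvd_free[OF \<alpha> c \<rho> m coeff_grading_in[OF r]] by blast
  then show False
    using lookup_coeff_grading[of r e k] k(1) by (simp add: e_def in_keys_iff)
qed

lemma genideal_pair:
  assumes "h \<in> polys_in {..<l}" "f \<in> polys_in {..<l}" "a \<in> polys_in {..<l}" "b \<in> polys_in {..<l}"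
  shows "a * h + b * f \<in> Idl\<^bsub>poly_ring l\<^esub> {h, f}"
proof -
  interpret S: cring "poly_ring l :: 'a mvpoly ring" by (rule cring_poly_ring)
  have sub: "{h, f} \<subseteq> carrier (poly_ring l)" using assms by (simp add: carrier_poly_ring)
  interpret J: ideal "Idl\<^bsub>poly_ring l\<^esub> {h, f}" "poly_ring l" by (rule S.genideal_ideal[OF sub])
  have "h \<in> Idl\<^bsub>poly_ring l\<^esub> {h, f}" "f \<in> Idl\<^bsub>poly_ring l\<^esub> {h, f}"
    using S.genideal_self[OF sub] by auto
  then have "a \<otimes>\<^bsub>poly_ring l\<^esub> h \<oplus>\<^bsub>poly_ring l\<^esub> b \<otimes>\<^bsub>poly_ring l\<^esub> f \<in> Idl\<^bsub>poly_ring l\<^esub> {h, f}"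
    using assms by (intro J.a_closed J.I_l_closed) (auto simp: carrier_poly_ring)
  then show ?thesis by (simp add: poly_ring_def)
qed

text \<open>
  If \<open>\<alpha>\<close> divides all \<open>g i\<close>, then \<open>h = 0\<close> is a nontrivial common divisor modulo \<open>\<alpha>\<close>.
\<close>

lemma linear_not_common_divisor:
  assumes "\<not> nontrivial_common_divisor_mod l I g \<alpha>"
    and \<alpha>: "\<alpha> \<in> polys_in {..<l}" "\<alpha> \<noteq> 0" and g: "\<And>i. i \<in> I \<Longrightarrow> g i \<in> polys_in {..<l}"
  shows "\<exists>k\<in>I. \<not> \<alpha> dvd g k"
proof (rule ccontr)
  assume neg: "\<not> (\<exists>k\<in>I. \<not> \<alpha> dvd g k)"
  have "g i \<in> Idl\<^bsub>poly_ring l\<^esub> {0, \<alpha>}" if i: "i \<in> I" for i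
  proof -
    obtain q where q: "g i = \<alpha> * q" using neg i unfolding dvd_def by blast
    then have "q \<in> polys_in {..<l}" using polys_in_quotient[OF _ \<alpha>(2)] g[OF i] by metis
    then show ?thesis using genideal_pair[OF polys_in_0 \<alpha>(1) polys_in_0, of q] q by (simp add: mult.commute)
  qed
  moreover have "0 \<in> positive_part l" by (simp add: positive_part_def carrier_poly_ring)
  ultimately show False using assms(1) unfolding nontrivial_common_divisor_mod_def by blast
qed

text \<open>
  In the quotient by \<open>\<alpha>\<close>, a factorial ring, \<open>h\<close> is proportional to \<open>g\<close>.  It is a multiple of \<open>g\<close> provided
  that the remainders \<open>r i\<close> of the \<open>g i\<close> have no common prime divisor.  As a divisor of a homogeneous
  polynomial, such a prime \<open>\<pi>\<close> is homogeneous of positive degree, so it would be a nontrivial common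
  divisor of the \<open>g i\<close> modulo \<open>\<alpha>\<close>.
\<close>

lemma proportional_mod_linear:
  assumes \<alpha>: "\<alpha> \<in> polys_in {..<l}" "homogeneous 1 \<alpha>" "\<alpha> \<noteq> 0"
    and g: "\<And>i. i \<in> I \<Longrightarrow> g i \<in> polys_in {..<l}" "\<And>i. i \<in> I \<Longrightarrow> \<exists>d. homogeneous d (g i)"
    and h: "\<And>i. i \<in> I \<Longrightarrow> h i \<in> polys_in {..<l}"
    and k: "k \<in> I" "\<not> \<alpha> dvd g k"
    and eq: "\<And>i. i \<in> I \<Longrightarrow> \<alpha> dvd g k * h i - h k * g i"
    and prim: "\<not> nontrivial_common_divisor_mod l I g \<alpha>"
  shows "\<exists>b\<in>polys_in {..<l}. \<forall>i\<in>I. \<alpha> dvd h i - b * g i"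
proof -
  obtain m c \<rho> where m: "m < l" and c: "c \<noteq> 0" and \<rho>: "\<rho> \<in> polys_in ({..<l} - {m})"
    and \<alpha>_eq: "\<alpha> = Const c * X m + \<rho>"
    using linear_decomposition[OF \<alpha>] by blast
  define W where "W = {..<l} - {m}"
  have W: "insert m W = {..<l}" "m \<notin> W" "finite W" using m by (auto simp: W_def)
  have sub: "p \<in> polys_in {..<l}" if "p \<in> polys_in W" for p :: "'a mvpoly"
    using that polys_in_mono[of W "{..<l}"] by (auto simp: W_def)
  note \<rho>' = \<rho>[folded W_def]
  have red: "\<exists>q r. p = \<alpha> * q + r \<and> r \<in> polys_in W" if "p \<in> polys_in {..<l}" for p
    using linear_reduction[OF \<alpha>_eq c \<rho>', of p] that W(1) by metis
  obtain q r where r: "\<And>i. i \<in> I \<Longrightarrow> g i = \<alpha> * q i + r i" "\<And>i. i \<in> I \<Longrightarrow> r i \<in> polys_in W"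
    using red[OF g(1)] by metis
  obtain q' s where s: "\<And>i. i \<in> I \<Longrightarrow> h i = \<alpha> * q' i + s i" "\<And>i. i \<in> I \<Longrightarrow> s i \<in> polys_in W"
    using red[OF h] by metis
  have rk: "r k \<noteq> 0" using k r(1)[OF k(1)] by auto
  have proportional: "r k * s i = s k * r i" if i: "i \<in> I" for i
  proof -
    have "g k * h i - h k * g i
        = \<alpha> * (q k * h i + r k * q' i - q' k * g i - s k * q i) + (r k * s i - s k * r i)"
      unfolding r(1)[OF i] r(1)[OF k(1)] s(1)[OF i] s(1)[OF k(1)] by (simp add: algebra_simps)
    then have "\<alpha> dvd r k * s i - s k * r i" using eq[OF i] by (simp add: dvd_add_right_iff)
    moreover have "r k * s i - s k * r i \<in> polys_in W" using r(2) s(2) i k(1) by simp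
    ultimately have "r k * s i - s k * r i = 0"
      using linear_dvd_free[OF \<alpha>_eq c \<rho>' W(2)] by blast
    then show ?thesis by simp
  qed
  have "\<exists>i\<in>I. \<not> \<pi> dvd r i" if \<pi>: "prime_in W \<pi>" for \<pi>
  proof (rule ccontr)
    assume neg: "\<not> (\<exists>i\<in>I. \<not> \<pi> dvd r i)"
    have \<pi>_in: "\<pi> \<in> polys_in {..<l}" using sub[OF prime_in_carrier[OF \<pi>]] .
    obtain d where "homogeneous d (g k)" using g(2)[OF k(1)] by blast
    then have rd: "homogeneous d (r k)"
      using linear_reduction_homogeneous[OF \<alpha>_eq c \<rho>' W(2) \<alpha>(2)] r k(1) by metis
    obtain t where "r k = \<pi> * t" using neg k(1) unfolding dvd_def by blast
    then obtain e where e: "homogeneous e \<pi>" using homogeneous_divisor rd rk by metis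
    have "e \<noteq> 0"
      using e is_unit_if_homogeneous_0 prime_in_not_0[OF \<pi>] \<pi> unfolding prime_in_def by metis
    then have "\<pi> \<in> positive_part l"
      using e \<pi>_in by (auto simp: positive_part_def carrier_poly_ring homogeneous_def)
    moreover have "g i \<in> Idl\<^bsub>poly_ring l\<^esub> {\<pi>, \<alpha>}" if i: "i \<in> I" for i
    proof -
      obtain t where t: "r i = \<pi> * t" using neg i unfolding dvd_def by blast
      have "t \<in> polys_in {..<l}"
        using polys_in_quotient[OF _ prime_in_not_0[OF \<pi>]] sub[OF r(2)[OF i]] t by metis
      moreover have "\<alpha> * q i = g i - r i" using r(1)[OF i] by simp
      then have "\<alpha> * q i \<in> polys_in {..<l}" using g(1)[OF i] sub[OF r(2)[OF i]] by simp
      then have "q i \<in> polys_in {..<l}" using polys_in_quotient[OF _ \<alpha>(3)] by blast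
      ultimately have "t * \<pi> + q i * \<alpha> \<in> Idl\<^bsub>poly_ring l\<^esub> {\<pi>, \<alpha>}"
        using genideal_pair[OF \<pi>_in \<alpha>(1)] by blast
      moreover have "g i = t * \<pi> + q i * \<alpha>" using r(1)[OF i] t by (simp add: algebra_simps)
      ultimately show ?thesis by simp
    qed
    ultimately show False using prim unfolding nontrivial_common_divisor_mod_def by blast
  qed
  from proportional_to_primitive[OF W(3) r(2) this r(2)[OF k(1)] rk s(2)[OF k(1)] proportional]
  obtain b where b: "\<And>i. i \<in> I \<Longrightarrow> s i = b * r i" by blast
  have "r k * b \<in> polys_in W" using b[OF k(1)] s(2)[OF k(1)] by (simp add: mult.commute)
  then have "b \<in> polys_in {..<l}" using polys_in_quotient[OF _ rk] sub by blast
  moreover have "\<alpha> dvd h i - b * g i" if i: "i \<in> I" for i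
  proof -
    have "h i - b * g i = \<alpha> * (q' i - b * q i)"
      unfolding r(1)[OF i] s(1)[OF i] b[OF i] by (simp add: algebra_simps)
    then show ?thesis by simp
  qed
  ultimately show ?thesis by blast
qed

section \<open>Linear combinations of logarithmic derivations\<close>

lemma log_der_module_apply:
  assumes "p \<in> polys_in {..<l}"
  shows "\<zero>\<^bsub>log_der_module l A\<^esub> p = 0"
    and "(\<eta> \<oplus>\<^bsub>log_der_module l A\<^esub> \<xi>) p = \<eta> p + \<xi> p"
    and "(f \<odot>\<^bsub>log_der_module l A\<^esub> \<eta>) p = f * \<eta> p"
  using assms by (simp_all add: log_der_module_def carrier_poly_ring)

lemma lin_comb_log_der:
  assumes "finite I" "\<And>i. i \<in> I \<Longrightarrow> x i \<in> log_der l A" "\<And>i. i \<in> I \<Longrightarrow> c i \<in> polys_in {..<l}"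
  shows "lin_comb (log_der_module l A) I c x \<in> log_der l A"
    and "p \<in> polys_in {..<l} \<Longrightarrow> lin_comb (log_der_module l A) I c x p = (\<Sum>i\<in>I. c i * x i p)"
proof -
  interpret M: module "poly_ring l" "log_der_module l A" by (rule module_log_der)
  have carr: "carrier (log_der_module l A) = log_der l A" by (simp add: log_der_module_def)
  have sm: "c i \<odot>\<^bsub>log_der_module l A\<^esub> x i \<in> carrier (log_der_module l A)" if "i \<in> I" for i
    using M.smult_closed[of "c i" "x i"] assms that by (simp add: carr carrier_poly_ring)
  then show "lin_comb (log_der_module l A) I c x \<in> log_der l A"
    unfolding lin_comb_def carr[symmetric] by (intro M.finsum_closed) auto
  show "lin_comb (log_der_module l A) I c x p = (\<Sum>i\<in>I. c i * x i p)" if p: "p \<in> polys_in {..<l}"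
    using assms(1) sm unfolding lin_comb_def
  proof (induction I rule: finite_induct)
    case empty
    then show ?case using p by (simp add: log_der_module_apply)
  next
    case (insert i F)
    then have "(\<Oplus>\<^bsub>log_der_module l A\<^esub>i\<in>insert i F. c i \<odot>\<^bsub>log_der_module l A\<^esub> x i)
      = c i \<odot>\<^bsub>log_der_module l A\<^esub> x i \<oplus>\<^bsub>log_der_module l A\<^esub> (\<Oplus>\<^bsub>log_der_module l A\<^esub>i\<in>F. c i \<odot>\<^bsub>log_der_module l A\<^esub> x i)"
      by (intro M.finsum_insert) auto
    then show ?case using insert p by (simp add: log_der_module_apply)
  qed
qed

lemma lin_comb_eq_iff:
  assumes "finite I" "\<And>i. i \<in> I \<Longrightarrow> x i \<in> log_der l A" "\<And>i. i \<in> I \<Longrightarrow> c i \<in> polys_in {..<l}"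
    and "\<eta> \<in> log_der l A"
  shows "lin_comb (log_der_module l A) I c x = \<eta> \<longleftrightarrow> (\<forall>j<l. (\<Sum>i\<in>I. c i * x i (X j)) = \<eta> (X j))"
proof -
  have X: "lin_comb (log_der_module l A) I c x (X j) = (\<Sum>i\<in>I. c i * x i (X j))" if "j < l" for j
    by (rule lin_comb_log_der(2)[OF assms(1-3)]) (use that in \<open>auto intro: polys_in_X\<close>)
  show ?thesis
  proof
    assume "\<forall>j<l. (\<Sum>i\<in>I. c i * x i (X j)) = \<eta> (X j)"
    then show "lin_comb (log_der_module l A) I c x = \<eta>"
      using X by (intro Der_eqI[OF log_der_Der[OF lin_comb_log_der(1)[OF assms(1-3)]] log_der_Der[OF assms(4)]]) auto
  qed (use X in auto)
qed

lemma log_der_module_zero: 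
  "\<zero>\<^bsub>log_der_module l A\<^esub> \<in> log_der l A"
  "j < l \<Longrightarrow> \<zero>\<^bsub>log_der_module l A\<^esub> (X j) = 0"
proof -
  interpret M: module "poly_ring l" "log_der_module l A" by (rule module_log_der)
  show "\<zero>\<^bsub>log_der_module l A\<^esub> \<in> log_der l A"
    using M.M.zero_closed by (simp add: log_der_module_def)
  show "j < l \<Longrightarrow> \<zero>\<^bsub>log_der_module l A\<^esub> (X j) = 0"
    by (simp add: log_der_module_apply polys_in_X)
qed

section \<open>Generators and relations\<close>

locale log_der_minors =
  fixes l :: nat
    and A :: "'k::field vec set set"
    and \<alpha> :: "'k vec set \<Rightarrow> 'k mvpoly"
    and \<theta> :: "nat \<Rightarrow> 'k mvpoly \<Rightarrow> 'k mvpoly"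
    and g :: "nat \<Rightarrow> 'k mvpoly"
  assumes A: "finite A" "\<And>H. H \<in> A \<Longrightarrow> defines_hyperplane l (\<alpha> H) H"
    and \<theta>: "\<And>i. i \<in> {1..l+1} \<Longrightarrow> \<theta> i \<in> log_der l A"
    and \<theta>_hom: "\<And>i. i \<in> {1..l+1} \<Longrightarrow> homogeneous_der l (\<theta> i)"
    and g: "\<And>i. i \<in> {1..l+1} \<Longrightarrow> g i \<in> polys_in {..<l}"
    and minor: "\<And>i. i \<in> {1..l+1} \<Longrightarrow> (-1) ^ i * det (coeff_minor l \<theta> i) = g i * (\<Prod>H\<in>A. \<alpha> H)"
    and linear_last: "homogeneous 1 (g (l + 1))" "g (l + 1) \<noteq> 0"
    and g_pos: "\<And>i. i \<in> {1..l} \<Longrightarrow> g i \<in> positive_part l"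
    and no_common: "\<not> nontrivial_common_divisor_mod l {1..l} g (g (l + 1))"
begin

lemma Q_nonzero: "(\<Prod>H\<in>A. \<alpha> H) \<noteq> 0"
  using A defines_hyperplaneD(3) by auto

lemma g_relation:
  assumes "c < l"
  shows "(\<Sum>i\<in>{1..l+1}. g i * \<theta> i (X c)) = 0"
proof -
  have "(\<Prod>H\<in>A. \<alpha> H) * (\<Sum>i\<in>{1..l+1}. g i * \<theta> i (X c))
      = (\<Sum>i\<in>{1..l+1}. (-1) ^ i * det (coeff_minor l \<theta> i) * \<theta> i (X c))"
    unfolding sum_distrib_left by (intro sum.cong refl) (simp only: minor mult_ac)
  also have "\<dots> = 0" by (rule signed_minors_relation[OF assms])
  finally show ?thesis using Q_nonzero by simp
qed

lemma index_shift: "i \<in> {1..l+1} \<Longrightarrow> r < l \<Longrightarrow> insert_index (i - 1) r + 1 \<in> {1..l+1}"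
  by (auto simp: insert_index_def)

lemma g_homogeneous:
  assumes i: "i \<in> {1..l+1}"
  shows "\<exists>d. homogeneous d (g i)"
proof (cases "g i = 0")
  case False
  define \<eta> where "\<eta> r = \<theta> (insert_index (i - 1) r + 1)" for r
  have "\<exists>d. \<forall>j<l. homogeneous d (\<eta> r (X j))" if "r < l" for r
    using \<theta>_hom[OF index_shift[OF i that]]
    unfolding homogeneous_der_def homog_part_def homogeneous_def \<eta>_def by blast
  then obtain d where d: "\<And>r j. r < l \<Longrightarrow> j < l \<Longrightarrow> homogeneous (d r) (\<eta> r (X j))" by metis
  have "homogeneous (\<Sum>r = 0..<l. d r) (det (coeff_minor l \<theta> i))"
    unfolding coeff_minor_eq[OF i] \<eta>_def[symmetric]
    by (rule det_homogeneous[OF der_matrix_carrier]) (simp add: d)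
  then have "homogeneous (\<Sum>r = 0..<l. d r) ((-1) ^ i * det (coeff_minor l \<theta> i))"
    by (cases "even i") auto
  then show ?thesis
    unfolding minor[OF i] using homogeneous_divisor False Q_nonzero by (metis mult_eq_0_iff)
qed auto

lemma g_not_unit:
  assumes i: "i \<in> {1..l+1}"
  shows "\<not> g i dvd 1"
proof (cases "g i = 0")
  case False
  obtain d where d: "homogeneous d (g i)" using g_homogeneous[OF i] by blast
  obtain k where k: "k \<in> Poly_Mapping.keys (g i)" using False by (metis ex_in_conv keys_eq_empty)
  have "mon_deg k \<ge> 1"
  proof (cases "i = l + 1")
    case True
    then show ?thesis using linear_last(1) k by (simp add: homogeneous_def)
  next
    case False
    then show ?thesis using g_pos[of i] i k by (auto simp: positive_part_def)
  qed
  then have "d > 0" using d k by (auto simp: homogeneous_def)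
  then show ?thesis using homogeneous_pos_not_unit[OF d] by blast
qed simp

lemma last_dvd_mult: "g (l + 1) dvd a * b \<Longrightarrow> g (l + 1) dvd a \<or> g (l + 1) dvd b"
  using homogeneous_linear_dvd_mult[OF g linear_last] by simp

lemma some_g_not_divisible: "\<exists>k\<in>{1..l}. \<not> g (l + 1) dvd g k"
  using linear_not_common_divisor[OF no_common] g linear_last by simp

text \<open>
  The minor without the last row is nonzero, so \<open>\<theta> 1, \<dots>, \<theta> l\<close> are linearly independent.  Hence a relation \<open>e\<close>
  is determined by its last entry: \<open>g (l + 1) * e i = e (l + 1) * g i\<close>.  The linear form
  \<open>g (l + 1)\<close> is prime and does not divide all \<open>g i\<close>, so it divides \<open>e (l + 1)\<close>.
\<close>

lemma relation_is_multiple_of_g: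
  assumes e: "\<And>i. i \<in> {1..l+1} \<Longrightarrow> e i \<in> polys_in {..<l}"
    and rel: "\<And>c. c < l \<Longrightarrow> (\<Sum>i\<in>{1..l+1}. e i * \<theta> i (X c)) = 0"
  shows "\<exists>a\<in>polys_in {..<l}. \<forall>i\<in>{1..l+1}. e i = a * g i"
proof -
  define \<beta> where "\<beta> = g (l + 1)"
  define f where "f i = \<beta> * e i - e (l + 1) * g i" for i
  let ?B = "coeff_minor l \<theta> (l + 1)"
  have B: "?B = der_matrix l (\<lambda>r. \<theta> (r + 1))"
    by (subst coeff_minor_eq) (auto simp: der_matrix_def intro!: eq_matI)
  have "f (r + 1) = 0" if r: "r < l" for r
  proof (rule rows_independent[of ?B l r "\<lambda>r. f (r + 1)", OF _ _ r])
    show "?B \<in> carrier_mat l l" unfolding B by simp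
    show "det ?B \<noteq> 0" using minor[of "l + 1"] linear_last(2) Q_nonzero by auto
    fix c assume c: "c < l"
    have "(\<Sum>k<l. f (k + 1) * ?B $$ (k, c)) = (\<Sum>k<l. f (k + 1) * \<theta> (k + 1) (X c))"
      using c unfolding B by simp
    also have "\<dots> = (\<Sum>i\<in>{1..l}. f i * \<theta> i (X c))"
      by (rule sum.reindex_bij_witness[of _ "\<lambda>i. i - 1" "\<lambda>r. r + 1"]) auto
    also have "\<dots> = (\<Sum>i\<in>{1..l+1}. f i * \<theta> i (X c))" by (simp add: f_def \<beta>_def)
    also have "\<dots> = \<beta> * (\<Sum>i\<in>{1..l+1}. e i * \<theta> i (X c)) - e (l + 1) * (\<Sum>i\<in>{1..l+1}. g i * \<theta> i (X c))"
      unfolding f_def sum_distrib_left sum_subtractf[symmetric]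
      by (intro sum.cong refl) (simp add: algebra_simps)
    also have "\<dots> = 0" by (simp only: rel[OF c] g_relation[OF c] mult_zero_right diff_self)
    finally show "(\<Sum>k<l. f (k + 1) * ?B $$ (k, c)) = 0" .
  qed
  note f0 = this
  have f: "\<beta> * e i = e (l + 1) * g i" if i: "i \<in> {1..l+1}" for i
  proof (cases "i = l + 1")
    case False
    then have "i - 1 < l" "i = i - 1 + 1" using i by auto
    then show ?thesis using f0[of "i - 1"] by (simp add: f_def)
  qed (simp add: \<beta>_def)
  obtain k where k: "k \<in> {1..l}" "\<not> \<beta> dvd g k" using some_g_not_divisible by (auto simp: \<beta>_def)
  have "\<beta> dvd e (l + 1) * g k" using f[of k] k(1) by (metis atLeastAtMost_iff dvd_triv_left trans_le_add1)
  then obtain a where a: "e (l + 1) = \<beta> * a" using last_dvd_mult k(2) unfolding \<beta>_def dvd_def by blast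
  have "a \<in> polys_in {..<l}"
    using polys_in_quotient[of \<beta> a "{..<l}"] a e[of "l + 1"] linear_last(2) unfolding \<beta>_def
    by (metis atLeastAtMost_iff le_add2 le_refl)
  moreover have "e i = a * g i" if "i \<in> {1..l+1}" for i
    using f[OF that] a linear_last(2) by (simp add: \<beta>_def)
  ultimately show ?thesis by blast
qed

lemma g_multiple_in_span:
  assumes \<eta>: "\<eta> \<in> log_der l A" and i: "i \<in> {1..l+1}"
  shows "\<exists>w. w i = 0 \<and> (\<forall>j. w j \<in> polys_in {..<l}) \<and>
    (\<forall>c<l. g i * \<eta> (X c) = (\<Sum>j\<in>{1..l+1}. w j * \<theta> j (X c)))"
proof -
  let ?\<tau> = "\<lambda>r. insert_index (i - 1) r + 1"
  have fam: "\<theta> (?\<tau> r) \<in> log_der l A" if "r < l" for r using \<theta>[OF index_shift[OF i that]] .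
  have u: "det (der_matrix l (\<lambda>r. \<theta> (?\<tau> r))) = ((-1) ^ i * g i) * (\<Prod>H\<in>A. \<alpha> H)"
    using arg_cong[OF minor[OF i], of "\<lambda>p. (-1) ^ i * p"]
    unfolding coeff_minor_eq[OF i] by (simp flip: mult.assoc power_mult_distrib)
  obtain w where w: "\<And>r. r < l \<Longrightarrow> w r \<in> polys_in {..<l}"
    "\<And>c. c < l \<Longrightarrow> (-1) ^ i * g i * \<eta> (X c) = (\<Sum>r<l. w r * \<theta> (?\<tau> r) (X c))"
    by (rule cramer_log_der[OF A fam \<eta> u]) blast+
  define w' where "w' j = (if j \<in> {1..l+1} - {i} then (-1) ^ i * w (delete_index (i - 1) (j - 1)) else 0)" for j
  have w'_\<tau>: "w' (?\<tau> r) = (-1) ^ i * w r" if "r < l" for r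
    using bij_betwE[OF insert_index_bij[OF i]] that unfolding w'_def by simp
  have "w' j \<in> polys_in {..<l}" for j
  proof (cases "j \<in> {1..l+1} - {i}")
    case True
    then obtain r where "r < l" "j = ?\<tau> r"
      using bij_betw_imp_surj_on[OF insert_index_bij[OF i]] by blast
    then show ?thesis using w'_\<tau> w(1) by simp
  next
    case False
    then have "w' j = 0" unfolding w'_def by (rule if_not_P)
    then show ?thesis by simp
  qed
  moreover have "g i * \<eta> (X c) = (\<Sum>j\<in>{1..l+1}. w' j * \<theta> j (X c))" if c: "c < l" for c
  proof -
    have "(\<Sum>j\<in>{1..l+1}. w' j * \<theta> j (X c)) = (\<Sum>j\<in>{1..l+1} - {i}. w' j * \<theta> j (X c))"
      by (intro sum.mono_neutral_right) (auto simp: w'_def)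
    also have "\<dots> = (\<Sum>r<l. w' (?\<tau> r) * \<theta> (?\<tau> r) (X c))"
      by (rule sum.reindex_bij_betw[OF insert_index_bij[OF i], symmetric])
    also have "\<dots> = (-1) ^ i * (\<Sum>r<l. w r * \<theta> (?\<tau> r) (X c))"
      unfolding sum_distrib_left by (intro sum.cong refl) (simp only: lessThan_iff w'_\<tau> mult.assoc)
    also have "\<dots> = g i * \<eta> (X c)"
      unfolding w(2)[OF c, symmetric] by (simp flip: mult.assoc power_mult_distrib)
    finally show ?thesis by simp
  qed
  ultimately show ?thesis by (intro exI[of _ w']) (auto simp: w'_def)
qed

text \<open>
  With \<open>\<beta> = g (l + 1)\<close>, both \<open>\<beta> * \<eta> = \<Sum>j. h j * \<theta> j\<close> and \<open>g k * \<eta> = \<Sum>j. w j * \<theta> j\<close> by Cramer's rule, where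
  \<open>\<theta> (l + 1)\<close> is absent from the first and \<open>\<theta> k\<close> from the second combination.  Eliminating \<open>\<eta>\<close> gives a
  relation, which is a multiple of \<open>g\<close>; looking at its entry \<open>k\<close> shows that the multiplier is \<open>- h k\<close>.
  Therefore \<open>h\<close> is proportional to \<open>g\<close> modulo \<open>\<beta>\<close>, so \<open>h i = b * g i + \<beta> * C i\<close> for some \<open>b\<close>.  Subtracting
  \<open>b\<close> times the relation \<open>g\<close> and cancelling \<open>\<beta>\<close> writes \<open>\<eta>\<close> as a combination with coefficients \<open>C i\<close>.
\<close>

lemma log_der_in_span:
  assumes \<eta>: "\<eta> \<in> log_der l A"
  shows "\<exists>C. (\<forall>i\<in>{1..l+1}. C i \<in> polys_in {..<l}) \<and>
    (\<forall>c<l. (\<Sum>i\<in>{1..l+1}. C i * \<theta> i (X c)) = \<eta> (X c))"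
proof -
  define \<beta> where "\<beta> = g (l + 1)"
  have \<beta>: "\<beta> \<in> polys_in {..<l}" "homogeneous 1 \<beta>" "\<beta> \<noteq> 0" using g linear_last by (auto simp: \<beta>_def)
  obtain k where k: "k \<in> {1..l}" "\<not> \<beta> dvd g k" using some_g_not_divisible by (auto simp: \<beta>_def)
  then have kI: "k \<in> {1..l+1}" by auto
  obtain h where h: "h (l + 1) = 0" "\<And>j. h j \<in> polys_in {..<l}"
    "\<And>c. c < l \<Longrightarrow> \<beta> * \<eta> (X c) = (\<Sum>j\<in>{1..l+1}. h j * \<theta> j (X c))"
    using g_multiple_in_span[OF \<eta>, of "l + 1"] unfolding \<beta>_def by auto
  obtain w where w: "w k = 0" "\<And>j. w j \<in> polys_in {..<l}"
    "\<And>c. c < l \<Longrightarrow> g k * \<eta> (X c) = (\<Sum>j\<in>{1..l+1}. w j * \<theta> j (X c))"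
    using g_multiple_in_span[OF \<eta> kI] by auto
  have "(\<Sum>j\<in>{1..l+1}. (\<beta> * w j - g k * h j) * \<theta> j (X c)) = 0" if c: "c < l" for c
  proof -
    have "(\<Sum>j\<in>{1..l+1}. (\<beta> * w j - g k * h j) * \<theta> j (X c))
      = \<beta> * (\<Sum>j\<in>{1..l+1}. w j * \<theta> j (X c)) - g k * (\<Sum>j\<in>{1..l+1}. h j * \<theta> j (X c))"
      unfolding sum_distrib_left sum_subtractf[symmetric] by (intro sum.cong refl) (simp add: algebra_simps)
    also have "\<dots> = 0" unfolding w(3)[OF c, symmetric] h(3)[OF c, symmetric] by (simp add: mult_ac)
    finally show ?thesis .
  qed
  then have "\<exists>a\<in>polys_in {..<l}. \<forall>j\<in>{1..l+1}. \<beta> * w j - g k * h j = a * g j"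
    by (intro relation_is_multiple_of_g) (simp_all only: polys_in_diff polys_in_mult \<beta>(1) w(2) h(2) g[OF kI])
  then obtain a where a: "\<And>j. j \<in> {1..l+1} \<Longrightarrow> \<beta> * w j - g k * h j = a * g j" by blast
  have "g k \<noteq> 0" using k(2) by auto
  moreover have "a * g k = - h k * g k" using a[OF kI] w(1) by (simp add: mult.commute)
  ultimately have "a = - h k" using mult_right_cancel by blast
  then have "\<beta> dvd g k * h j - h k * g j" if "j \<in> {1..l}" for j
  proof -
    have "g k * h j - h k * g j = \<beta> * w j" using a[of j] that \<open>a = - h k\<close> by (simp add: algebra_simps)
    then show ?thesis by simp
  qed
  then obtain b where b: "b \<in> polys_in {..<l}" "\<And>i. i \<in> {1..l} \<Longrightarrow> \<beta> dvd h i - b * g i"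
    using proportional_mod_linear[OF \<beta>, of "{1..l}" g h k] g g_homogeneous h(2) k no_common
    unfolding \<beta>_def by force
  have "\<exists>C. h i - b * g i = \<beta> * C" if "i \<in> {1..l+1}" for i
  proof (cases "i = l + 1")
    case True
    \<comment> \<open>here \<open>h i = 0\<close> and \<open>g i = \<beta>\<close>\<close>
    then show ?thesis using h(1) by (intro exI[of _ "- b"]) (simp add: \<beta>_def)
  next
    case False
    then show ?thesis using b(2)[of i] that unfolding dvd_def by auto
  qed
  then obtain C where C: "\<And>i. i \<in> {1..l+1} \<Longrightarrow> h i - b * g i = \<beta> * C i" by metis
  have "C i \<in> polys_in {..<l}" if "i \<in> {1..l+1}" for i
    using polys_in_quotient[OF _ \<beta>(3)] C[OF that] h(2) b(1) g[OF that]
    by (metis polys_in_diff polys_in_mult)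
  moreover have "(\<Sum>i\<in>{1..l+1}. C i * \<theta> i (X c)) = \<eta> (X c)" if c: "c < l" for c
  proof -
    have "\<beta> * (\<Sum>i\<in>{1..l+1}. C i * \<theta> i (X c))
        = (\<Sum>i\<in>{1..l+1}. (h i - b * g i) * \<theta> i (X c))"
      unfolding sum_distrib_left by (intro sum.cong refl) (simp only: C mult.assoc)
    also have "\<dots> = (\<Sum>i\<in>{1..l+1}. h i * \<theta> i (X c)) - b * (\<Sum>i\<in>{1..l+1}. g i * \<theta> i (X c))"
      unfolding sum_distrib_left sum_subtractf[symmetric] by (intro sum.cong refl) (simp add: algebra_simps)
    also have "\<dots> = \<beta> * \<eta> (X c)" unfolding g_relation[OF c] h(3)[OF c] by simp
    finally show ?thesis using \<beta>(3) by simp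
  qed
  ultimately show ?thesis by blast
qed

lemma lin_comb_\<theta>_eq_iff:
  assumes "\<And>i. i \<in> {1..l+1} \<Longrightarrow> c i \<in> polys_in {..<l}" "\<eta> \<in> log_der l A"
  shows "lin_comb (log_der_module l A) {1..l+1} c \<theta> = \<eta> \<longleftrightarrow>
    (\<forall>j<l. (\<Sum>i\<in>{1..l+1}. c i * \<theta> i (X j)) = \<eta> (X j))"
  by (rule lin_comb_eq_iff[OF finite_atLeastAtMost _ _ assms(2)]) (use \<theta> assms(1) in blast)+

lemma generates_log_der: "generates (poly_ring l) (log_der_module l A) {1..l+1} \<theta>"
  unfolding generates_def
proof (intro conjI equalityI subsetI)
  show "\<theta> \<in> {1..l+1} \<rightarrow> carrier (log_der_module l A)" using \<theta> by (auto simp: log_der_module_def)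
  fix \<eta> assume "\<eta> \<in> carrier (log_der_module l A)"
  then have \<eta>: "\<eta> \<in> log_der l A" by (simp add: log_der_module_def)
  obtain C where C: "\<And>i. i \<in> {1..l+1} \<Longrightarrow> C i \<in> polys_in {..<l}"
    "\<forall>c<l. (\<Sum>i\<in>{1..l+1}. C i * \<theta> i (X c)) = \<eta> (X c)" using log_der_in_span[OF \<eta>] by blast
  then have "lin_comb (log_der_module l A) {1..l+1} C \<theta> = \<eta>"
    using C(2) by (simp only: lin_comb_\<theta>_eq_iff[of C, OF C(1) \<eta>])
  then show "\<eta> \<in> {lin_comb (log_der_module l A) {1..l+1} c \<theta> | c. c \<in> {1..l+1} \<rightarrow> carrier (poly_ring l)}"
    using C(1) by (auto simp: carrier_poly_ring intro!: exI[of _ C])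
next
  fix \<eta> assume "\<eta> \<in> {lin_comb (log_der_module l A) {1..l+1} c \<theta> | c. c \<in> {1..l+1} \<rightarrow> carrier (poly_ring l)}"
  then obtain c where "\<eta> = lin_comb (log_der_module l A) {1..l+1} c \<theta>" "c \<in> {1..l+1} \<rightarrow> polys_in {..<l}"
    by (auto simp: carrier_poly_ring)
  moreover from this have "lin_comb (log_der_module l A) {1..l+1} c \<theta> \<in> log_der l A"
    using \<theta> by (intro lin_comb_log_der(1)) auto
  ultimately show "\<eta> \<in> carrier (log_der_module l A)" by (simp add: log_der_module_def)
qed

text \<open>
  A redundant generator \<open>\<theta> i\<close> gives a relation with the unit \<open>- 1\<close> in position \<open>i\<close>.  It would be a multiple of
  \<open>g\<close>, but \<open>g i\<close> is not a unit.
\<close>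

lemma \<theta>_minimal_generators: "minimal_generators (poly_ring l) (log_der_module l A) {1..l+1} \<theta>"
  unfolding minimal_generators_def
proof (intro conjI allI impI notI generates_log_der)
  fix J :: "nat set" assume J: "J \<subset> {1..l+1}" and gen: "generates (poly_ring l) (log_der_module l A) J \<theta>"
  obtain i where i: "i \<in> {1..l+1}" "i \<notin> J" using J by blast
  have fin: "finite J" using J finite_subset by blast
  have "\<theta> i \<in> carrier (log_der_module l A)" using \<theta>[OF i(1)] by (simp add: log_der_module_def)
  then obtain c where c: "\<theta> i = lin_comb (log_der_module l A) J c \<theta>" "c \<in> J \<rightarrow> polys_in {..<l}"
    using gen unfolding generates_def carrier_poly_ring by auto
  define e where "e j = (if j = i then - 1 else if j \<in> J then c j else 0)" for j
  have "(\<Sum>j\<in>{1..l+1}. e j * \<theta> j (X d)) = 0" if d: "d < l" for d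
  proof -
    have "\<theta> i (X d) = (\<Sum>j\<in>J. c j * \<theta> j (X d))"
      unfolding c(1)
    proof (rule lin_comb_log_der(2)[OF fin])
      show "\<theta> j \<in> log_der l A" if "j \<in> J" for j using \<theta> that J by blast
    qed (use c(2) d in \<open>auto intro: polys_in_X\<close>)
    moreover have "(\<Sum>j\<in>{1..l+1}. e j * \<theta> j (X d)) = (\<Sum>j\<in>insert i J. e j * \<theta> j (X d))"
      using J i by (intro sum.mono_neutral_right) (auto simp: e_def)
    moreover have "\<dots> = - \<theta> i (X d) + (\<Sum>j\<in>J. c j * \<theta> j (X d))"
      using fin i(2) by (simp add: e_def) (intro sum.cong, auto)
    ultimately show ?thesis by simp
  qed
  moreover have "e j \<in> polys_in {..<l}" for j using c(2) by (auto simp: e_def)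
  ultimately obtain a where "e i = a * g i" using relation_is_multiple_of_g[of e] i(1) by blast
  then have "1 = g i * (- a)" by (simp add: e_def mult.commute minus_equation_iff)
  then show False using g_not_unit[OF i(1)] by (metis dvdI)
qed

lemma g_unique_relation: "unique_relation (poly_ring l) (log_der_module l A) {1..l+1} \<theta> g"
  unfolding unique_relation_def
proof (intro conjI equalityI subsetI)
  show "g \<in> {1..l+1} \<rightarrow> carrier (poly_ring l)" using g by (auto simp: carrier_poly_ring)
  have zero_iff: "lin_comb (log_der_module l A) {1..l+1} c \<theta> = \<zero>\<^bsub>log_der_module l A\<^esub> \<longleftrightarrow>
      (\<forall>j<l. (\<Sum>i\<in>{1..l+1}. c i * \<theta> i (X j)) = 0)" if "\<And>i. i \<in> {1..l+1} \<Longrightarrow> c i \<in> polys_in {..<l}" for c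
  proof -
    have "lin_comb (log_der_module l A) {1..l+1} c \<theta> = \<zero>\<^bsub>log_der_module l A\<^esub> \<longleftrightarrow>
        (\<forall>j<l. (\<Sum>i\<in>{1..l+1}. c i * \<theta> i (X j)) = \<zero>\<^bsub>log_der_module l A\<^esub> (X j))"
      by (rule lin_comb_\<theta>_eq_iff[OF that log_der_module_zero(1)])
    then show ?thesis by (simp add: log_der_module_zero(2))
  qed
  {
    fix c assume "c \<in> {c \<in> {1..l+1} \<rightarrow>\<^sub>E carrier (poly_ring l).
      lin_comb (log_der_module l A) {1..l+1} c \<theta> = \<zero>\<^bsub>log_der_module l A\<^esub>}"
    then have c: "c \<in> {1..l+1} \<rightarrow>\<^sub>E polys_in {..<l}"
      "lin_comb (log_der_module l A) {1..l+1} c \<theta> = \<zero>\<^bsub>log_der_module l A\<^esub>" by (auto simp: carrier_poly_ring)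
    then have "\<And>i. i \<in> {1..l+1} \<Longrightarrow> c i \<in> polys_in {..<l}" by (auto simp: PiE_iff)
    then obtain a where a: "a \<in> polys_in {..<l}" "\<And>i. i \<in> {1..l+1} \<Longrightarrow> c i = a * g i"
      using relation_is_multiple_of_g[of c] zero_iff[of c] c(2) by blast
    then have "c = (\<lambda>i\<in>{1..l+1}. a \<otimes>\<^bsub>poly_ring l\<^esub> g i)"
      using c(1) by (auto simp: fun_eq_iff PiE_iff extensional_def poly_ring_def)
    then show "c \<in> {\<lambda>i\<in>{1..l+1}. a \<otimes>\<^bsub>poly_ring l\<^esub> g i | a. a \<in> carrier (poly_ring l)}"
      using a(1) by (auto simp: carrier_poly_ring)
  next
    fix c assume "c \<in> {\<lambda>i\<in>{1..l+1}. a \<otimes>\<^bsub>poly_ring l\<^esub> g i | a. a \<in> carrier (poly_ring l)}"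
    then obtain a where a: "a \<in> polys_in {..<l}" "c = (\<lambda>i\<in>{1..l+1}. a * g i)"
      by (auto simp: carrier_poly_ring) (simp add: poly_ring_def)
    have cl: "c i \<in> polys_in {..<l}" if "i \<in> {1..l+1}" for i using a g[OF that] that by simp
    have "(\<Sum>i\<in>{1..l+1}. c i * \<theta> i (X j)) = 0" if "j < l" for j
    proof -
      have "(\<Sum>i\<in>{1..l+1}. c i * \<theta> i (X j)) = a * (\<Sum>i\<in>{1..l+1}. g i * \<theta> i (X j))"
        unfolding sum_distrib_left a(2) by (intro sum.cong refl) (simp add: mult.assoc)
      then show ?thesis by (simp only: g_relation[OF that] mult_zero_right)
    qed
    then have "lin_comb (log_der_module l A) {1..l+1} c \<theta> = \<zero>\<^bsub>log_der_module l A\<^esub>"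
      by (subst zero_iff[of c, OF cl]) auto
    moreover have "c \<in> {1..l+1} \<rightarrow>\<^sub>E carrier (poly_ring l)"
      using cl unfolding a(2) by (auto simp: carrier_poly_ring)
    ultimately show "c \<in> {c \<in> {1..l+1} \<rightarrow>\<^sub>E carrier (poly_ring l).
      lin_comb (log_der_module l A) {1..l+1} c \<theta> = \<zero>\<^bsub>log_der_module l A\<^esub>}" by blast
  }
qed

end

section \<open>Derivations whose minors have no common divisor generate\<close>

theorem theorem1p3:
  fixes l :: nat
    and A :: "'k::field vec set set"
    and \<alpha> :: "'k vec set \<Rightarrow> 'k mvpoly"
    and Q :: "'k mvpoly"
    and \<theta> :: "nat \<Rightarrow> 'k mvpoly \<Rightarrow> 'k mvpoly"
    and g :: "nat \<Rightarrow> 'k mvpoly"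
  assumes "central_arrangement l A"
    and "\<And>H. H \<in> A \<Longrightarrow> defines_hyperplane l (\<alpha> H) H"
    and "Q = (\<Prod>H\<in>A. \<alpha> H)"
    and "\<And>i. i \<in> {1..l+1} \<Longrightarrow> \<theta> i \<in> log_der l A"
    and "\<And>i. i \<in> {1..l+1} \<Longrightarrow> homogeneous_der l (\<theta> i)"
    and "\<And>i. i \<in> {1..l+1} \<Longrightarrow> g i \<in> carrier (poly_ring l)"
    and "\<And>i. i \<in> {1..l+1} \<Longrightarrow> (-1) ^ i * det (coeff_minor l \<theta> i) = g i * Q"
    and "g (l + 1) \<in> homog_part l 1 - {0}"
    and "\<And>i. i \<in> {1..l} \<Longrightarrow> g i \<in> positive_part l"
    and "\<not> nontrivial_common_divisor_mod l {1..l} g (g (l + 1))"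
    and "proj_dim TYPE('p) (poly_ring l) (log_der_module l A) \<le> 1"
  shows "SPOG l A \<and>
    minimal_generators (poly_ring l) (log_der_module l A) {1..l+1} \<theta> \<and>
    unique_relation (poly_ring l) (log_der_module l A) {1..l+1} \<theta> g"
proof -
  interpret log_der_minors l A \<alpha> \<theta> g
  proof
    show "finite A" using assms(1) by (simp add: central_arrangement_def)
    show "homogeneous 1 (g (l + 1))" using assms(8) by (simp add: homog_part_def homogeneous_def)
    show "(-1) ^ i * det (coeff_minor l \<theta> i) = g i * (\<Prod>H\<in>A. \<alpha> H)" if "i \<in> {1..l+1}" for i
      using assms(7)[OF that] by (simp only: assms(3))
  qed (use assms in \<open>simp_all add: carrier_poly_ring\<close>)
  show ?thesis
    using \<theta>_minimal_generators g_unique_relation assms(5,8) unfolding SPOG_def by blast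
qed

end
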